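(* Let $g_N=g_E/V_g$ on $\mathcal{M}$ and let $V:\mathcal{M}\to\mathbb{R}_{>0}$, $V(g)=V_g$, be the volume function. The Hessian of $\log V$ with respect to $g_N$ satisfies $$\nabla^{g_N}\,d\log V=0.$$ In particular, $\log V$ is linear along $g_N$-geodesics, and $V$ is either strictly monotone or constant along each $g_N$-geodesic.
   Context: $M$ is an $n$-dimensional compact closed manifold and $\mathcal{M}$ is the space of all smooth Riemannian metrics on $M$, an open cone in the Fréchet space $\Gamma(S^2T^*M)$ of smooth symmetric $(0,2)$-tensor fields; so $T_g\mathcal{M}\cong\Gamma(S^2T^*M)$. The Ebin metric is the (weak) Riemannian metric on $\mathcal{M}$ given by $g_E(h,k)|_g=\int_M \mathrm{tr}(g^{-1}hg^{-1}k)\,dV_g$. $V_g=\int_M dV_g$ is the total volume of $(M,g)$. The generalized Calabi metric is $g_N(h,k)|_g=\frac{1}{V_g}g_E(h,k)|_g$; it has a Levi-Civita connection $\nabla^{g_N}$ (torsion-free and metric compatible), and geodesics are taken with respect to it. "Linear along a geodesic" means affine as a function of the affine parameter $t$. *)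

theory Defs
  imports "HOL-Analysis.Analysis" "HOL-Library.Function_Algebras"
begin

section \<open>Smooth maps between Euclidean spaces\<close>

text \<open>
  \<open>iter_deriv [v\<^sub>1, \<dots>, v\<^sub>k] f x\<close> is the iterated directional derivative of \<open>f\<close> at \<open>x\<close>.
  On an open set, \<open>f\<close> is smooth iff all of these functions are differentiable.
\<close>

primrec iter_deriv ::
  "'a::real_normed_vector list \<Rightarrow> ('a \<Rightarrow> 'b::real_normed_vector) \<Rightarrow> 'a \<Rightarrow> 'b" where
  "iter_deriv [] f = f"
| "iter_deriv (v # vs) f = (\<lambda>x. frechet_derivative (iter_deriv vs f) (at x) v)"

definition smooth_on ::
  "'a::real_normed_vector set \<Rightarrow> ('a \<Rightarrow> 'b::real_normed_vector) \<Rightarrow> bool" where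
  "smooth_on S f \<longleftrightarrow> open S \<and> (\<forall>vs. \<forall>x\<in>S. iter_deriv vs f differentiable (at x))"


section \<open>Closed manifolds\<close>

text \<open>
  The points of the manifold are the elements of a type \<open>'m\<close>. A chart is a pair \<open>(U, \<phi>)\<close> of its
  domain and its coordinate map; only the values of \<open>\<phi>\<close> on \<open>U\<close> are meaningful. The smooth structure
  is given by any (not necessarily maximal) smooth atlas. Second countability is automatic for a
  compact space covered by charts.
\<close>

type_synonym ('m, 'n) chart = "'m set \<times> ('m \<Rightarrow> real^'n)"

definition chart_inv :: "('m, 'n::finite) chart \<Rightarrow> real^'n \<Rightarrow> 'm" where
  "chart_inv c = inv_into (fst c) (snd c)"

definition transition :: "('m, 'n::finite) chart \<Rightarrow> ('m, 'n) chart \<Rightarrow> real^'n \<Rightarrow> real^'n" where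
  "transition c d = snd d \<circ> chart_inv c"

definition smooth_atlas :: "('m::t2_space, 'n::finite) chart set \<Rightarrow> bool" where
  "smooth_atlas A \<longleftrightarrow>
     (\<Union>c\<in>A. fst c) = UNIV \<and>
     (\<forall>c\<in>A. open (fst c) \<and> open (snd c ` fst c) \<and>
        homeomorphism (fst c) (snd c ` fst c) (snd c) (chart_inv c)) \<and>
     (\<forall>c\<in>A. \<forall>d\<in>A. smooth_on (snd c ` (fst c \<inter> fst d)) (transition c d))"

definition closed_manifold :: "('m::t2_space, 'n::finite) chart set \<Rightarrow> bool" where
  "closed_manifold A \<longleftrightarrow> compact (UNIV :: 'm set) \<and> smooth_atlas A"


section \<open>Symmetric tensor fields and Riemannian metrics\<close>

text \<open>
  A \<open>(0,2)\<close>-tensor field is given by its component matrices: \<open>h c p $ i $ j\<close> is the component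
  \<open>h\<^sub>i\<^sub>j\<close> at the point \<open>p\<close> in the chart \<open>c\<close>. The components are set to \<open>0\<close> where they have no meaning
  (charts outside the atlas, points outside the domain), so that equal tensor fields are equal
  HOL functions. Addition is pointwise.
\<close>

type_synonym ('m, 'n) tensor = "('m, 'n) chart \<Rightarrow> 'm \<Rightarrow> real^'n^'n"

definition tscale :: "real \<Rightarrow> ('m, 'n::finite) tensor \<Rightarrow> ('m, 'n) tensor"
  (infixr \<open>*\<^sub>T\<close> 75) where
  "a *\<^sub>T h = (\<lambda>c p. a *\<^sub>R h c p)"

definition components :: "('m, 'n::finite) tensor \<Rightarrow> ('m, 'n) chart \<Rightarrow> real^'n \<Rightarrow> real^'n^'n" where
  "components h c x = h c (chart_inv c x)"

definition jacobian :: "('m, 'n::finite) chart \<Rightarrow> ('m, 'n) chart \<Rightarrow> 'm \<Rightarrow> real^'n^'n" where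
  "jacobian c d p = matrix (frechet_derivative (transition c d) (at (snd c p)))"

definition sym_tensor_fields :: "('m::t2_space, 'n::finite) chart set \<Rightarrow> ('m, 'n) tensor set" where
  "sym_tensor_fields A = {h.
     (\<forall>c p. \<not> (c \<in> A \<and> p \<in> fst c) \<longrightarrow> h c p = 0) \<and>
     (\<forall>c\<in>A. \<forall>p\<in>fst c. transpose (h c p) = h c p) \<and>
     (\<forall>c\<in>A. \<forall>d\<in>A. \<forall>p\<in>fst c \<inter> fst d.
        h c p = transpose (jacobian c d p) ** h d p ** jacobian c d p) \<and>
     (\<forall>c\<in>A. smooth_on (snd c ` fst c) (components h c))}"

definition riem_metrics :: "('m::t2_space, 'n::finite) chart set \<Rightarrow> ('m, 'n) tensor set" where
  "riem_metrics A = {g \<in> sym_tensor_fields A.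
     \<forall>c\<in>A. \<forall>p\<in>fst c. \<forall>v. v \<noteq> 0 \<longrightarrow> v \<bullet> (g c p *v v) > 0}"


section \<open>Riemannian volume, Ebin metric and generalized Calabi metric\<close>

text \<open>The Riemannian density \<open>dV\<^sub>g = \<surd>(det g) dx\<close>, as a Borel measure; no orientation is needed.\<close>

definition is_riem_volume ::
  "('m::t2_space, 'n::finite) chart set \<Rightarrow> ('m, 'n) tensor \<Rightarrow> 'm measure \<Rightarrow> bool" where
  "is_riem_volume A g \<mu> \<longleftrightarrow>
     sets \<mu> = sets borel \<and>
     (\<forall>c\<in>A. \<forall>B\<in>sets borel. B \<subseteq> fst c \<longrightarrow>
        emeasure \<mu> B =
          (\<integral>\<^sup>+x\<in>snd c ` B. ennreal (sqrt (det (components g c x))) \<partial>lborel))"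

definition riem_volume ::
  "('m::t2_space, 'n::finite) chart set \<Rightarrow> ('m, 'n) tensor \<Rightarrow> 'm measure" where
  "riem_volume A g = (THE \<mu>. is_riem_volume A g \<mu>)"

definition total_volume ::
  "('m::t2_space, 'n::finite) chart set \<Rightarrow> ('m, 'n) tensor \<Rightarrow> real" where
  "total_volume A g = measure (riem_volume A g) UNIV"

definition chart_at :: "('m, 'n::finite) chart set \<Rightarrow> 'm \<Rightarrow> ('m, 'n) chart" where
  "chart_at A p = (SOME c. c \<in> A \<and> p \<in> fst c)"

text \<open>\<open>tr(g\<^sup>-\<^sup>1 h g\<^sup>-\<^sup>1 k)\<close> as a function on the manifold. The trace does not depend on the chart used.\<close>

definition trace_pairing ::
  "('m, 'n::finite) chart set \<Rightarrow> ('m, 'n) tensor \<Rightarrow> ('m, 'n) tensor \<Rightarrow> ('m, 'n) tensor \<Rightarrow> 'm \<Rightarrow> real"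
  where
  "trace_pairing A g h k p =
     (let c = chart_at A p; gi = matrix_inv (g c p) in trace (gi ** h c p ** gi ** k c p))"

definition ebin_metric ::
  "('m::t2_space, 'n::finite) chart set \<Rightarrow> ('m, 'n) tensor \<Rightarrow> ('m, 'n) tensor \<Rightarrow> ('m, 'n) tensor \<Rightarrow> real"
  where
  "ebin_metric A g h k = (\<integral>p. trace_pairing A g h k p \<partial>riem_volume A g)"

definition calabi_metric ::
  "('m::t2_space, 'n::finite) chart set \<Rightarrow> ('m, 'n) tensor \<Rightarrow> ('m, 'n) tensor \<Rightarrow> ('m, 'n) tensor \<Rightarrow> real"
  where
  "calabi_metric A g h k = ebin_metric A g h k / total_volume A g"


section \<open>Calculus in the Frechet space of symmetric tensor fields\<close>

text \<open>
  Convergence in the Frechet (\<open>C\<^sup>\<infinity>\<close>) topology: in every chart, all iterated derivatives of the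
  components converge uniformly on compact sets.
\<close>

definition tensor_tendsto ::
  "('m, 'n::finite) chart set \<Rightarrow> ('b \<Rightarrow> ('m, 'n) tensor) \<Rightarrow> ('m, 'n) tensor \<Rightarrow> 'b filter \<Rightarrow> bool" where
  "tensor_tendsto A H h F \<longleftrightarrow>
     (\<forall>c\<in>A. \<forall>K vs. compact K \<and> K \<subseteq> snd c ` fst c \<longrightarrow>
        uniform_limit K (\<lambda>t. iter_deriv vs (components (H t) c)) (iter_deriv vs (components h c)) F)"

definition has_tensor_deriv ::
  "('m, 'n::finite) chart set \<Rightarrow> real set \<Rightarrow> (real \<Rightarrow> ('m, 'n) tensor) \<Rightarrow> ('m, 'n) tensor \<Rightarrow> real \<Rightarrow> bool"
  where
  "has_tensor_deriv A J \<gamma> h t \<longleftrightarrow>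
     tensor_tendsto A (\<lambda>u. (1 / (u - t)) *\<^sub>T (\<gamma> u - \<gamma> t)) h (at t within J)"

definition tensor_deriv ::
  "('m::t2_space, 'n::finite) chart set \<Rightarrow> real set \<Rightarrow> (real \<Rightarrow> ('m, 'n) tensor) \<Rightarrow> real \<Rightarrow> ('m, 'n) tensor"
  where
  "tensor_deriv A J \<gamma> t = (THE h. h \<in> sym_tensor_fields A \<and> has_tensor_deriv A J \<gamma> h t)"

definition smooth_curve ::
  "('m::t2_space, 'n::finite) chart set \<Rightarrow> real set \<Rightarrow> (real \<Rightarrow> ('m, 'n) tensor) \<Rightarrow> bool" where
  "smooth_curve A J \<gamma> \<longleftrightarrow>
     (\<exists>D. D 0 = \<gamma> \<and>
        (\<forall>k. \<forall>t\<in>J. D k t \<in> sym_tensor_fields A \<and> has_tensor_deriv A J (D k) (D (Suc k) t) t))"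

text \<open>
  The space of metrics is an open subset of the Frechet space of symmetric tensor fields, so a
  vector field on it is a map into that space. Smoothness of maps is that of convenient calculus:
  smooth curves are mapped to smooth curves. On Frechet spaces this agrees with smoothness in the
  sense of Michal--Bastiani and Hamilton.
\<close>

definition smooth_vector_field ::
  "('m::t2_space, 'n::finite) chart set \<Rightarrow> (('m, 'n) tensor \<Rightarrow> ('m, 'n) tensor) \<Rightarrow> bool" where
  "smooth_vector_field A X \<longleftrightarrow>
     (\<forall>\<gamma>. smooth_curve A UNIV \<gamma> \<and> range \<gamma> \<subseteq> riem_metrics A \<longrightarrow> smooth_curve A UNIV (X \<circ> \<gamma>))"

definition dir_deriv ::
  "(('m, 'n::finite) tensor \<Rightarrow> real) \<Rightarrow> ('m, 'n) tensor \<Rightarrow> ('m, 'n) tensor \<Rightarrow> real" where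
  "dir_deriv f g h = deriv (\<lambda>s. f (g + s *\<^sub>T h)) 0"

definition field_dir_deriv ::
  "('m::t2_space, 'n::finite) chart set \<Rightarrow> (('m, 'n) tensor \<Rightarrow> ('m, 'n) tensor) \<Rightarrow>
     ('m, 'n) tensor \<Rightarrow> ('m, 'n) tensor \<Rightarrow> ('m, 'n) tensor" where
  "field_dir_deriv A Y g h = tensor_deriv A UNIV (\<lambda>s. Y (g + s *\<^sub>T h)) 0"

definition lie_bracket ::
  "('m::t2_space, 'n::finite) chart set \<Rightarrow> (('m, 'n) tensor \<Rightarrow> ('m, 'n) tensor) \<Rightarrow>
     (('m, 'n) tensor \<Rightarrow> ('m, 'n) tensor) \<Rightarrow> ('m, 'n) tensor \<Rightarrow> ('m, 'n) tensor" where
  "lie_bracket A X Y g = field_dir_deriv A Y g (X g) - field_dir_deriv A X g (Y g)"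


section \<open>Connections on the space of metrics\<close>

text \<open>
  A linear connection on an open subset of a Frechet space is given by a smooth Christoffel map
  \<open>\<Gamma>\<close>, bilinear in its last two arguments: \<open>\<nabla>\<^sub>X Y = dY(X) + \<Gamma>(X, Y)\<close>.
\<close>

type_synonym ('m, 'n) christoffel =
  "('m, 'n) tensor \<Rightarrow> ('m, 'n) tensor \<Rightarrow> ('m, 'n) tensor \<Rightarrow> ('m, 'n) tensor"

definition linear_connection ::
  "('m::t2_space, 'n::finite) chart set \<Rightarrow> ('m, 'n) christoffel \<Rightarrow> bool" where
  "linear_connection A \<Gamma> \<longleftrightarrow>
     (\<forall>g\<in>riem_metrics A. \<forall>h\<in>sym_tensor_fields A. \<forall>k\<in>sym_tensor_fields A.
        \<Gamma> g h k \<in> sym_tensor_fields A \<and>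
        (\<forall>l\<in>sym_tensor_fields A.
           \<Gamma> g (h + l) k = \<Gamma> g h k + \<Gamma> g l k \<and> \<Gamma> g h (k + l) = \<Gamma> g h k + \<Gamma> g h l) \<and>
        (\<forall>a. \<Gamma> g (a *\<^sub>T h) k = a *\<^sub>T \<Gamma> g h k \<and> \<Gamma> g h (a *\<^sub>T k) = a *\<^sub>T \<Gamma> g h k)) \<and>
     (\<forall>\<gamma> \<eta> \<kappa>. smooth_curve A UNIV \<gamma> \<and> range \<gamma> \<subseteq> riem_metrics A \<and>
        smooth_curve A UNIV \<eta> \<and> smooth_curve A UNIV \<kappa> \<longrightarrow>
        smooth_curve A UNIV (\<lambda>t. \<Gamma> (\<gamma> t) (\<eta> t) (\<kappa> t)))"

definition covariant_deriv ::
  "('m::t2_space, 'n::finite) chart set \<Rightarrow> ('m, 'n) christoffel \<Rightarrow>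
     (('m, 'n) tensor \<Rightarrow> ('m, 'n) tensor) \<Rightarrow> (('m, 'n) tensor \<Rightarrow> ('m, 'n) tensor) \<Rightarrow>
     ('m, 'n) tensor \<Rightarrow> ('m, 'n) tensor" where
  "covariant_deriv A \<Gamma> X Y g = field_dir_deriv A Y g (X g) + \<Gamma> g (X g) (Y g)"

definition levi_civita ::
  "('m::t2_space, 'n::finite) chart set \<Rightarrow>
     (('m, 'n) tensor \<Rightarrow> ('m, 'n) tensor \<Rightarrow> ('m, 'n) tensor \<Rightarrow> real) \<Rightarrow> ('m, 'n) christoffel \<Rightarrow> bool"
  where
  "levi_civita A G \<Gamma> \<longleftrightarrow>
     linear_connection A \<Gamma> \<and>
     (\<forall>X Y. smooth_vector_field A X \<and> smooth_vector_field A Y \<longrightarrow>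
        (\<forall>g\<in>riem_metrics A.
           covariant_deriv A \<Gamma> X Y g - covariant_deriv A \<Gamma> Y X g = lie_bracket A X Y g)) \<and>
     (\<forall>X Y Z. smooth_vector_field A X \<and> smooth_vector_field A Y \<and> smooth_vector_field A Z \<longrightarrow>
        (\<forall>g\<in>riem_metrics A.
           dir_deriv (\<lambda>g'. G g' (Y g') (Z g')) g (X g) =
             G g (covariant_deriv A \<Gamma> X Y g) (Z g) + G g (Y g) (covariant_deriv A \<Gamma> X Z g)))"

text \<open>
  \<open>(\<nabla>\<^sub>h \<omega>)(k) = h(\<omega>(k)) - \<omega>(\<nabla>\<^sub>h k)\<close> with the tangent vectors \<open>h\<close>, \<open>k\<close> at \<open>g\<close> extended to constant
  vector fields, for which \<open>\<nabla>\<^sub>h k = \<Gamma>(h, k)\<close>.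
\<close>

definition covariant_deriv_form ::
  "('m, 'n::finite) christoffel \<Rightarrow> (('m, 'n) tensor \<Rightarrow> ('m, 'n) tensor \<Rightarrow> real) \<Rightarrow>
     ('m, 'n) tensor \<Rightarrow> ('m, 'n) tensor \<Rightarrow> ('m, 'n) tensor \<Rightarrow> real" where
  "covariant_deriv_form \<Gamma> \<omega> g h k = dir_deriv (\<lambda>g'. \<omega> g' k) g h - \<omega> g (\<Gamma> g h k)"

definition hessian ::
  "('m, 'n::finite) christoffel \<Rightarrow> (('m, 'n) tensor \<Rightarrow> real) \<Rightarrow>
     ('m, 'n) tensor \<Rightarrow> ('m, 'n) tensor \<Rightarrow> ('m, 'n) tensor \<Rightarrow> real" where
  "hessian \<Gamma> f = covariant_deriv_form \<Gamma> (dir_deriv f)"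

text \<open>
  Geodesics are parametrized by arbitrary nondegenerate intervals, with one-sided derivatives at
  end points that belong to the interval.
\<close>

definition geodesic ::
  "('m::t2_space, 'n::finite) chart set \<Rightarrow> ('m, 'n) christoffel \<Rightarrow> real set \<Rightarrow>
     (real \<Rightarrow> ('m, 'n) tensor) \<Rightarrow> bool" where
  "geodesic A \<Gamma> J \<gamma> \<longleftrightarrow>
     is_interval J \<and> interior J \<noteq> {} \<and> smooth_curve A J \<gamma> \<and> \<gamma> ` J \<subseteq> riem_metrics A \<and>
     (\<forall>t\<in>J. tensor_deriv A J (tensor_deriv A J \<gamma>) t +
              \<Gamma> (\<gamma> t) (tensor_deriv A J \<gamma> t) (tensor_deriv A J \<gamma> t) = 0)"

end

theory Submission
  imports Defs
begin

text \<open>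
  Since \<open>tr(g\<^sup>-\<^sup>1 g g\<^sup>-\<^sup>1 k) = tr(g\<^sup>-\<^sup>1 k)\<close>, half of the radial field \<open>P(g) = g\<close> is the gradient of \<open>log V\<close>
  for \<open>g\<^sub>N\<close>, so the Hessian of \<open>log V\<close> is \<open>g\<^sub>N(\<nabla>\<^sub>h P, k) / 2\<close>. It is symmetric in \<open>h\<close> and \<open>k\<close>. It is also
  skew-symmetric: \<open>g\<^sub>N\<close> is invariant under scaling (both \<open>g\<^sub>E\<close> and \<open>V\<close> scale like the volume), so \<open>P\<close>
  is a Killing field. Hence it vanishes.

  The analytic input is the derivative of \<open>\<integral> tr(g\<^sup>-\<^sup>1 k) dV\<^sub>g\<close> along curves \<open>g\<close>, \<open>k\<close> of tensor fields. For
  \<open>k = g\<close> it contains the derivative of \<open>V\<close>, since that integral is then \<open>n V\<close>.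
\<close>

section \<open>Matrices\<close>

text \<open>The Levi-Civita conditions are evaluated only on constant fields and on the radial field
  P. For constant h one has nabla_h P = h + \<Gamma>(h, g), while compatibility in the direction of
  P reads -2 g_N(h, k) = g_N(\<Gamma>(g, h), k) + g_N(h, \<Gamma>(g, k)). The factor -2 is the
  derivative at 0 of (1 + s)^-2, the weight with which g_N scales on fixed tangent vectors; it
  cancels the two terms g_N(h, k) contributed by nabla_h P and nabla_k P.

  Much of the text prepares the measure. The volume is a definite description, so it has to be
  constructed from the charts before anything can be said about integrals. To differentiate, the
  volume of a nearby metric g' is written as the density sqrt(det(g^-1 g')) against the fixed volume
  of g: the parameter then sits in the integrand alone, and uniform convergence on the compact
  manifold suffices.\<close>

lemma
  fixes A :: "real^'n::finite^'n"
  assumes "det A \<noteq> 0"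
  shows matrix_inv_right: "A ** matrix_inv A = mat 1" and matrix_inv_left: "matrix_inv A ** A = mat 1"
proof -
  obtain B where "A ** B = mat 1 \<and> B ** A = mat 1"
    using assms unfolding invertible_det_nz[symmetric] invertible_def by blast
  then have "A ** matrix_inv A = mat 1 \<and> matrix_inv A ** A = mat 1"
    unfolding matrix_inv_def by (rule someI)
  then show "A ** matrix_inv A = mat 1" "matrix_inv A ** A = mat 1" by auto
qed

lemma matrix_inv_eqI:
  fixes A :: "real^'n::finite^'n"
  assumes "A ** B = mat 1"
  shows "matrix_inv A = B"
proof -
  have "det A * det B = 1" by (metis assms det_I det_mul)
  then have "det A \<noteq> 0" by auto
  then show ?thesis
    by (metis assms matrix_inv_left matrix_mul_assoc matrix_mul_lid matrix_mul_rid)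
qed

section \<open>Continuity of the matrix operations and the derivative of the determinant\<close>

lemma tendsto_matrix_matrix_mult:
  fixes f :: "'b \<Rightarrow> real^'n::finite^'m::finite" and g :: "'b \<Rightarrow> real^'k::finite^'n"
  assumes "(f \<longlongrightarrow> A) F" "(g \<longlongrightarrow> B) F"
  shows "((\<lambda>x. f x ** g x) \<longlongrightarrow> A ** B) F"
  unfolding matrix_matrix_mult_def
  by (intro tendsto_vec_lambda tendsto_sum tendsto_mult tendsto_vec_nth assms)

lemma tendsto_trace:
  fixes f :: "'b \<Rightarrow> real^'n::finite^'n"
  assumes "(f \<longlongrightarrow> A) F"
  shows "((\<lambda>x. trace (f x)) \<longlongrightarrow> trace A) F"
  unfolding trace_def by (intro tendsto_sum tendsto_vec_nth assms)

lemma tendsto_det: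
  fixes f :: "'b \<Rightarrow> real^'n::finite^'n"
  assumes "(f \<longlongrightarrow> A) F"
  shows "((\<lambda>x. det (f x)) \<longlongrightarrow> det A) F"
  unfolding det_def by (intro tendsto_sum tendsto_mult tendsto_prod tendsto_vec_nth assms tendsto_const)

text \<open>Quotients of determinants make the continuity of inversion visible; this is how
  \<open>tendsto_matrix_inv\<close> is obtained.\<close>

lemma matrix_inv_cramer:
  fixes A :: "real^'n::finite^'n"
  assumes "det A \<noteq> 0"
  shows "matrix_inv A = (\<chi> k l. det (\<chi> i j. if j = k then mat 1 $ i $ l else A $ i $ j) / det A)"
proof -
  have "A *v column l (matrix_inv A) = column l (mat 1)" for l
    by (metis matrix_inv_right[OF assms] matrix_vector_mul_assoc matrix_vector_mult_basis)
  then have col: "column l (matrix_inv A) =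
      (\<chi> k. det (\<chi> i j. if j = k then column l (mat 1) $ i else A $ i $ j) / det A)" for l
    using cramer[OF assms] by blast
  have "column l (matrix_inv A) $ k =
      det (\<chi> i j. if j = k then column l (mat 1) $ i else A $ i $ j) / det A" for k l
    using arg_cong[OF col[of l], of "\<lambda>v. v $ k"] by (simp only: vec_lambda_beta)
  then show ?thesis unfolding column_def vec_lambda_beta by (simp only: vec_eq_iff vec_lambda_beta simp_thms)
qed

lemma tendsto_matrix_inv:
  fixes f :: "'b \<Rightarrow> real^'n::finite^'n"
  assumes f: "(f \<longlongrightarrow> A) F" and A: "det A \<noteq> 0"
  shows "((\<lambda>x. matrix_inv (f x)) \<longlongrightarrow> matrix_inv A) F"
proof -
  have "((\<lambda>x. \<chi> k l. det (\<chi> i j. if j = k then mat 1 $ i $ l else f x $ i $ j) / det (f x))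
      \<longlongrightarrow> (\<chi> k l. det (\<chi> i j. if j = k then mat 1 $ i $ l else A $ i $ j) / det A)) F"
  proof (intro tendsto_vec_lambda tendsto_divide tendsto_det f A)
    fix k l i j
    show "((\<lambda>x. if j = k then mat 1 $ i $ l else f x $ i $ j) \<longlongrightarrow>
        (if j = k then mat 1 $ i $ l else A $ i $ j)) F"
      using f by (cases "j = k") (auto intro!: tendsto_vec_nth)
  qed
  moreover have "eventually (\<lambda>x. det (f x) \<noteq> 0) F"
    by (rule tendsto_imp_eventually_ne[OF tendsto_det[OF f] A])
  then have "eventually (\<lambda>x. (\<chi> k l. det (\<chi> i j. if j = k then mat 1 $ i $ l else f x $ i $ j) / det (f x))
      = matrix_inv (f x)) F"
    by eventually_elim (rule matrix_inv_cramer[symmetric])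
  ultimately show ?thesis
    unfolding matrix_inv_cramer[OF A] by (rule Lim_transform_eventually)
qed

text \<open>A product rule in which the step \<open>e\<close> and the directions \<open>b\<close>
  both vary along an arbitrary filter. In the application the filter combines the parameter with the
  base point on the manifold, so a derivative at a fixed point would not be enough.\<close>

lemma prod_perturb_quotient:
  fixes a :: "'i \<Rightarrow> real" and b :: "'i \<Rightarrow> 'b \<Rightarrow> real"
  assumes "finite S" and "\<And>i. i \<in> S \<Longrightarrow> (b i \<longlongrightarrow> b0 i) F" and e: "(e \<longlongrightarrow> 0) F"
    and nz: "eventually (\<lambda>x. e x \<noteq> 0) F"
  shows "((\<lambda>x. ((\<Prod>i\<in>S. a i + e x * b i x) - (\<Prod>i\<in>S. a i)) / e x)
    \<longlongrightarrow> (\<Sum>i\<in>S. b0 i * (\<Prod>j\<in>S - {i}. a j))) F"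
  using assms(1,2)
proof (induction S)
  case empty
  then show ?case by simp
next
  case (insert k S)
  let ?P = "\<lambda>x. \<Prod>i\<in>S. a i + e x * b i x"
  let ?p = "\<Prod>i\<in>S. a i"
  \<comment> \<open>Splitting off the factor \<open>k\<close>: the new difference is the perturbed
    factor times the old difference, plus \<open>e x * b k x\<close> times the unperturbed
    product.\<close>
  have e2: "((\<lambda>x. (a k + e x * b k x) * (((?P x) - ?p) / e x) + b k x * ?p)
      \<longlongrightarrow> (a k + 0 * b0 k) * (\<Sum>i\<in>S. b0 i * (\<Prod>j\<in>S - {i}. a j)) + b0 k * ?p) F"
    by (intro tendsto_intros insert.IH e insert.prems) auto
  have "(\<Sum>i\<in>S. b0 i * (\<Prod>j\<in>insert k S - {i}. a j)) = (\<Sum>i\<in>S. b0 i * (a k * (\<Prod>j\<in>S - {i}. a j)))"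
  proof (rule sum.cong)
    fix i assume "i \<in> S"
    then have "insert k S - {i} = insert k (S - {i})" using insert.hyps by auto
    then show "b0 i * (\<Prod>j\<in>insert k S - {i}. a j) = b0 i * (a k * (\<Prod>j\<in>S - {i}. a j))"
      using insert.hyps by simp
  qed simp
  moreover have "insert k S - {k} = S" using insert.hyps by auto
  ultimately have lim: "(\<Sum>i\<in>insert k S. b0 i * (\<Prod>j\<in>insert k S - {i}. a j)) =
      (a k + 0 * b0 k) * (\<Sum>i\<in>S. b0 i * (\<Prod>j\<in>S - {i}. a j)) + b0 k * ?p"
    using insert.hyps by (simp add: sum_distrib_left mult_ac)
  have "eventually (\<lambda>x. (a k + e x * b k x) * ((?P x - ?p) / e x) + b k x * ?p =
      ((\<Prod>i\<in>insert k S. a i + e x * b i x) - (\<Prod>i\<in>insert k S. a i)) / e x) F"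
    using nz by eventually_elim (use insert.hyps in \<open>simp add: field_simps\<close>)
  with e2 show ?case unfolding lim by (rule Lim_transform_eventually)
qed

lemma permutes_all_but_one:
  assumes "p permutes UNIV" "\<And>j. j \<noteq> i \<Longrightarrow> p j = j"
  shows "p = id"
proof
  fix j show "p j = id j"
    by (metis assms eq_id_iff permutes_inverses(1) permutes_not_in permutes_univ)
qed

text \<open>Jacobi's formula at the identity, with varying direction. Other base points are reduced
  to this one by multiplying with the inverse matrix.\<close>

lemma det_mat_1_quotient:
  fixes B :: "'b \<Rightarrow> real^'n::finite^'n"
  assumes B: "(B \<longlongrightarrow> B0) F" and e: "(e \<longlongrightarrow> 0) F" and nz: "eventually (\<lambda>x. e x \<noteq> 0) F"
  shows "((\<lambda>x. (det (mat 1 + e x *\<^sub>R B x) - 1) / e x) \<longlongrightarrow> trace B0) F"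
proof -
  let ?P = "{p. p permutes (UNIV :: 'n set)}"
  let ?m = "mat 1 :: real^'n^'n"
  let ?t = "\<lambda>p. \<Sum>i\<in>UNIV. B0 $ i $ p i * (\<Prod>j\<in>UNIV - {i}. ?m $ j $ p j)"
  have "((\<lambda>x. \<Sum>p\<in>?P. of_int (sign p) * (((\<Prod>i\<in>UNIV. ?m $ i $ p i + e x * B x $ i $ p i)
      - (\<Prod>i\<in>UNIV. ?m $ i $ p i)) / e x)) \<longlongrightarrow> (\<Sum>p\<in>?P. of_int (sign p) * ?t p)) F"
    by (intro tendsto_sum tendsto_mult tendsto_const prod_perturb_quotient e nz tendsto_vec_nth B) auto
  moreover have "(\<Sum>p\<in>?P. of_int (sign p) * (((\<Prod>i\<in>UNIV. ?m $ i $ p i + e x * B x $ i $ p i)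
      - (\<Prod>i\<in>UNIV. ?m $ i $ p i)) / e x)) = (det (?m + e x *\<^sub>R B x) - det ?m) / e x" for x
    by (simp only: det_def sum_subtractf[symmetric] sum_divide_distrib right_diff_distrib[symmetric]
        times_divide_eq_right vector_add_component vector_scaleR_component real_scaleR_def)
  moreover have "(\<Sum>p\<in>?P. of_int (sign p) * ?t p) = trace B0"
  proof -
    \<comment> \<open>A permutation other than the identity moves two points, so it contributes to second order only.\<close>
    have "?t p = 0" if p: "p permutes UNIV" "p \<noteq> id" for p
    proof -
      have "(\<Prod>j\<in>UNIV - {i}. ?m $ j $ p j) = 0" for i
      proof -
        obtain j where "j \<noteq> i" "p j \<noteq> j" using permutes_all_but_one p by metis
        then show ?thesis by (intro prod_zero) (auto simp: mat_def intro!: bexI[of _ j])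
      qed
      then show ?thesis by (simp only: mult_zero_right sum.neutral_const)
    qed
    then have "(\<Sum>p\<in>?P. of_int (sign p) * ?t p) = (\<Sum>p\<in>{id}. of_int (sign p) * ?t p)"
      by (intro sum.mono_neutral_right) (auto simp: permutes_id finite_permutations)
    also have "\<dots> = trace B0" by (simp add: trace_def mat_def)
    finally show ?thesis .
  qed
  ultimately show ?thesis by simp
qed

lemma pos_def_det_pos:
  fixes A :: "real^'n::finite^'n"
  assumes "\<And>v. v \<noteq> 0 \<Longrightarrow> v \<bullet> (A *v v) > 0"
  shows "det A > 0"
proof (rule ccontr)
  assume neg: "\<not> det A > 0"
  \<comment> \<open>The determinant has no zero on the segment from the identity to \<open>A\<close>.\<close>
  define f where "f s = det ((1 - s) *\<^sub>R mat 1 + s *\<^sub>R A)" for s :: real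
  have "continuous_on {0..1} f"
    unfolding f_def continuous_on_def by (intro ballI tendsto_det tendsto_intros)
  moreover have "f 0 = 1" "f 1 = det A" by (simp_all add: f_def)
  ultimately obtain s where s: "0 \<le> s" "s \<le> 1" "f s = 0"
    using IVT2'[of f 1 0 0] neg by (auto simp: not_less)
  then obtain v where v: "v \<noteq> 0" "((1 - s) *\<^sub>R mat 1 + s *\<^sub>R A) *v v = 0"
    unfolding f_def using invertible_det_nz matrix_left_invertible_ker invertible_left_inverse by metis
  have "0 = v \<bullet> (((1 - s) *\<^sub>R mat 1 + s *\<^sub>R A) *v v)" using v by simp
  also have "\<dots> = (1 - s) * (v \<bullet> v) + s * (v \<bullet> (A *v v))"
    by (simp add: matrix_vector_mult_add_rdistrib scaleR_matrix_vector_assoc[symmetric] inner_add_right)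
  \<comment> \<open>At \<open>s = 1\<close> only the second summand is positive; for smaller
    \<open>s\<close> the first one is.\<close>
  also have "\<dots> > 0"
    using s v(1) assms[OF v(1)]
    by (cases "s = 1") (auto intro!: add_pos_nonneg mult_pos_pos)
  finally show False by simp
qed

section \<open>Change of variables and gluing of measures\<close>

text \<open>Translates between the nonnegative integral, in which \<open>is_riem_volume\<close> is
  stated, and the gauge integral, in which the change of variables theorem is stated.\<close>

lemma nn_integral_eq_iff_absolutely_integrable:
  fixes f :: "'a::euclidean_space \<Rightarrow> real"
  assumes f: "f \<in> borel_measurable borel" and nn: "\<And>x. 0 \<le> f x" and z: "\<And>x. x \<notin> S \<Longrightarrow> f x = 0" and r: "0 \<le> r"
  shows "(\<integral>\<^sup>+x. f x \<partial>lborel) = ennreal r \<longleftrightarrow> f absolutely_integrable_on S \<and> integral S f = r"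
proof -
  have U: "(f has_integral r) S \<longleftrightarrow> (f has_integral r) UNIV"
    using z has_integral_restrict_UNIV[of S f r] by (smt (verit, best) has_integral_cong)
  have "f absolutely_integrable_on S \<and> integral S f = r \<longleftrightarrow> (f has_integral r) S"
    using nn by (auto simp: absolutely_integrable_on_def has_integral_iff)
  moreover have "(\<integral>\<^sup>+x. f x \<partial>lborel) = ennreal r \<longleftrightarrow> (f has_integral r) UNIV"
    using has_integral_iff_nn_integral_lebesgue[of f r] nn f r
    by (auto simp: nn_integral_completion measurable_completion)
  ultimately show ?thesis using U by simp
qed

text \<open>The transformed integrand is supplied as a Borel function \<open>h\<close> in its own
  right. For two charts, \<open>h\<close> is the density of the first chart, so its measurability
  comes from continuity of the metric and not from the Jacobian factor.\<close>

lemma nn_integral_change_of_variables: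
  fixes f :: "real^'n::{finite,wellorder} \<Rightarrow> real" and T :: "real^'n::_ \<Rightarrow> real^'n::_"
  assumes S: "S \<in> sets borel"
    and der: "\<And>x. x \<in> S \<Longrightarrow> (T has_derivative T' x) (at x within S)"
    and inj: "inj_on T S"
    and f: "f \<in> borel_measurable borel" "\<And>x. 0 \<le> f x" "\<And>y. y \<notin> T ` S \<Longrightarrow> f y = 0"
    and h: "h \<in> borel_measurable borel" "\<And>x. x \<in> S \<Longrightarrow> h x = \<bar>det (matrix (T' x))\<bar> * f (T x)"
      "\<And>x. x \<notin> S \<Longrightarrow> h x = 0"
  shows "(\<integral>\<^sup>+x. ennreal (h x) \<partial>lborel) = (\<integral>\<^sup>+x. ennreal (f x) \<partial>lborel)"
proof -
  have nn: "0 \<le> h x" for x using f(2) h(2,3) by (cases "x \<in> S") auto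
  have S': "S \<in> sets lebesgue" using S by (simp add: sets_completionI_sets)
  have cv: "(\<lambda>x. \<bar>det (matrix (T' x))\<bar> *\<^sub>R f (T x)) absolutely_integrable_on S \<and>
      integral S (\<lambda>x. \<bar>det (matrix (T' x))\<bar> *\<^sub>R f (T x)) = r
      \<longleftrightarrow> f absolutely_integrable_on (T ` S) \<and> integral (T ` S) f = r" for r
  proof -
    \<comment> \<open>The theorem is about vector-valued integrands, so the real integrand passes
      through \<open>real^1\<close>.\<close>
    have "(\<lambda>x. \<bar>det (matrix (T' x))\<bar> *\<^sub>R (vec (f (T x)) :: real^1)) absolutely_integrable_on S \<and>
        integral S (\<lambda>x. \<bar>det (matrix (T' x))\<bar> *\<^sub>R (vec (f (T x)) :: real^1)) = vec r
        \<longleftrightarrow> (\<lambda>x. vec (f x) :: real^1) absolutely_integrable_on (T ` S) \<and>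
          integral (T ` S) (\<lambda>x. vec (f x) :: real^1) = vec r"
      by (rule has_absolute_integral_change_of_variables[OF S' der inj])
    then show ?thesis by (simp add: absolutely_integrable_on_1_iff integral_on_1_eq)
  qed
  have hS: "(\<lambda>x. \<bar>det (matrix (T' x))\<bar> *\<^sub>R f (T x)) absolutely_integrable_on S \<longleftrightarrow> h absolutely_integrable_on S"
    by (rule absolutely_integrable_spike_eq[where S="{}"]) (auto simp: h)
  have hI: "integral S (\<lambda>x. \<bar>det (matrix (T' x))\<bar> *\<^sub>R f (T x)) = integral S h"
    by (rule integral_cong) (auto simp: h)
  \<comment> \<open>An equivalence for every finite value also settles the infinite case: a finite
    value on either side would transfer to the other.\<close>
  have iff: "(\<integral>\<^sup>+x. h x \<partial>lborel) = ennreal r \<longleftrightarrow> (\<integral>\<^sup>+x. f x \<partial>lborel) = ennreal r" if "0 \<le> r" for r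
    using cv[of r] nn_integral_eq_iff_absolutely_integrable[of f "T ` S" r, OF f that]
      nn_integral_eq_iff_absolutely_integrable[of h S r, OF h(1) nn h(3) that] hS hI by simp
  show ?thesis
  proof (cases "\<integral>\<^sup>+x. ennreal (f x) \<partial>lborel" rule: ennreal_cases)
    case (real r)
    with iff[of r] show ?thesis by (simp only:)
  next
    case top
    show ?thesis
    proof (cases "\<integral>\<^sup>+x. ennreal (h x) \<partial>lborel" rule: ennreal_cases)
      case (real r)
      then have "(\<integral>\<^sup>+x. ennreal (f x) \<partial>lborel) = ennreal r" using iff[of r] by blast
      with real show ?thesis by (simp only:)
    next
      case top2: top
      show ?thesis by (simp only: top top2)
    qed
  qed
qed

text \<open>The cover cuts a measurable set into finitely many disjoint pieces, each inside one
  \<open>U i\<close>, and additivity adds them up. This gives uniqueness of the Riemannian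
  volume.\<close>

lemma emeasure_eq_on_coverI:
  assumes "sets M = sets K" "sets N = sets K" and J: "finite J" "space K \<subseteq> (\<Union>i\<in>J. U i)"
    and U: "\<And>i. i \<in> J \<Longrightarrow> U i \<in> sets K"
    and eq: "\<And>i B. i \<in> J \<Longrightarrow> B \<in> sets K \<Longrightarrow> B \<subseteq> U i \<Longrightarrow> emeasure M B = emeasure N B"
  shows "M = N"
proof (rule measure_eqI)
  show "sets M = sets N" using assms by simp
  fix B assume "B \<in> sets M"
  then have B: "B \<in> sets K" using assms by simp
  have "emeasure M (B \<inter> (\<Union>i\<in>I. U i)) = emeasure N (B \<inter> (\<Union>i\<in>I. U i))" if "I \<subseteq> J" for I
    using finite_subset[OF that J(1)] that
  proof (induction I)
    case (insert i I)
    let ?W = "\<Union>i\<in>I. U i"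
    have W: "?W \<in> sets K" using insert.hyps(1) insert.prems U by (intro sets.finite_UN) auto
    have *: "B \<inter> (\<Union>j\<in>insert i I. U j) = (B \<inter> ?W) \<union> (B \<inter> (U i - ?W))" by auto
    have "emeasure L (B \<inter> (\<Union>j\<in>insert i I. U j)) = emeasure L (B \<inter> ?W) + emeasure L (B \<inter> (U i - ?W))"
      if "sets L = sets K" for L
      unfolding * using W B U[of i] insert.prems that by (intro plus_emeasure[symmetric]) auto
    moreover have "emeasure M (B \<inter> (U i - ?W)) = emeasure N (B \<inter> (U i - ?W))"
      using insert.prems W B U[of i] by (intro eq[of i]) auto
    moreover have "emeasure M (B \<inter> ?W) = emeasure N (B \<inter> ?W)" using insert by blast
    ultimately show ?case by (simp only: assms(1,2))
  qed simp
  from this[of J] show "emeasure M B = emeasure N B"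
    using Int_absorb2[of B "\<Union>i\<in>J. U i"] order.trans[OF sets.sets_into_space[OF B] J(2)] by simp
qed

text \<open>The measure grows along the finite subcover \<open>J\<close>, one member at a time. The
  induction invariant compares with \<open>M i\<close> for every \<open>i\<close> in
  \<open>I\<close>, including those outside \<open>J\<close>, because the conclusion concerns the
  whole family; \<open>agree\<close> is what makes this possible.\<close>

lemma glue_measures:
  assumes sets: "\<And>i. i \<in> I \<Longrightarrow> sets (M i) = sets K"
    and U: "\<And>i. i \<in> I \<Longrightarrow> U i \<in> sets K"
    and J: "finite J" "J \<subseteq> I" "space K \<subseteq> (\<Union>i\<in>J. U i)"
    and agree: "\<And>i j B. i \<in> I \<Longrightarrow> j \<in> I \<Longrightarrow> B \<in> sets K \<Longrightarrow> B \<subseteq> U i \<inter> U j \<Longrightarrow>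
      emeasure (M i) B = emeasure (M j) B"
  shows "\<exists>N. sets N = sets K \<and> (\<forall>i\<in>I. \<forall>B\<in>sets K. B \<subseteq> U i \<longrightarrow> emeasure N B = emeasure (M i) B)"
proof -
  have "\<exists>N. sets N = sets K \<and> (\<forall>i\<in>I. \<forall>B\<in>sets K. B \<subseteq> U i \<inter> (\<Union>j\<in>L. U j) \<longrightarrow> emeasure N B = emeasure (M i) B)"
    if "L \<subseteq> J" for L
    using finite_subset[OF that J(1)] that
  proof (induction L)
    case empty
    show ?case by (intro exI[of _ "null_measure K"]) auto
  next
    case (insert l L)
    then obtain N where N: "sets N = sets K"
      "\<And>i B. i \<in> I \<Longrightarrow> B \<in> sets K \<Longrightarrow> B \<subseteq> U i \<inter> (\<Union>j\<in>L. U j) \<Longrightarrow> emeasure N B = emeasure (M i) B"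
      using insert.IH insert.prems by (metis (no_types, lifting) insert_subset)
    have l: "l \<in> I" using insert.prems J(2) by auto
    let ?W = "\<Union>j\<in>L. U j"
    have W: "?W \<in> sets K" using insert.hyps(1) insert.prems U J(2) by (intro sets.finite_UN) auto
    \<comment> \<open>Keep the measure already built on the union so far and let \<open>M l\<close>
      measure the rest. What \<open>M l\<close> does outside \<open>U l\<close> is harmless, as the
      invariant looks only at subsets of the enlarged union.\<close>
    let ?f = "\<lambda>B. emeasure N (B \<inter> ?W) + emeasure (M l) (B - ?W)"
    let ?N = "measure_of (space K) (sets K) ?f"
    have "countably_additive (sets K) ?f"
    proof (unfold countably_additive_def, intro allI impI)
      fix B :: "nat \<Rightarrow> 'b set" assume B: "range B \<subseteq> sets K" "disjoint_family B" "\<Union> (range B) \<in> sets K"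
      have "(\<Sum>i. ?f (B i)) = (\<Sum>i. emeasure N (B i \<inter> ?W)) + (\<Sum>i. emeasure (M l) (B i - ?W))"
        by (rule suminf_add[symmetric]) auto
      also have "(\<Sum>i. emeasure N (B i \<inter> ?W)) = emeasure N (\<Union>i. B i \<inter> ?W)"
        using B W N(1) by (intro suminf_emeasure) (auto simp: disjoint_family_on_def)
      also have "(\<Sum>i. emeasure (M l) (B i - ?W)) = emeasure (M l) (\<Union>i. B i - ?W)"
        using B W sets[OF l] by (intro suminf_emeasure) (auto simp: disjoint_family_on_def)
      also have "(\<Union>i. B i \<inter> ?W) = \<Union> (range B) \<inter> ?W" by auto
      also have "(\<Union>i. B i - ?W) = \<Union> (range B) - ?W" by auto
      finally show "(\<Sum>i. ?f (B i)) = ?f (\<Union> (range B))" .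
    qed
    then have em: "emeasure ?N B = ?f B" if "B \<in> sets K" for B
      using that by (intro emeasure_measure_of_sigma sets.sigma_algebra_axioms) (auto simp: positive_def)
    have "emeasure ?N B = emeasure (M i) B"
      if i: "i \<in> I" and B: "B \<in> sets K" "B \<subseteq> U i \<inter> (\<Union>j\<in>insert l L. U j)" for i B
    proof -
      have "emeasure N (B \<inter> ?W) = emeasure (M i) (B \<inter> ?W)"
        using B W by (intro N(2) i) auto
      moreover have "emeasure (M l) (B - ?W) = emeasure (M i) (B - ?W)"
        using B W by (intro agree i l) auto
      moreover have "emeasure (M i) (B \<inter> ?W) + emeasure (M i) (B - ?W) = emeasure (M i) ((B \<inter> ?W) \<union> (B - ?W))"
        using B W sets[OF i] by (intro plus_emeasure) auto
      moreover have "(B \<inter> ?W) \<union> (B - ?W) = B" by auto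
      ultimately show ?thesis by (simp add: em[OF B(1)])
    qed
    moreover have "sets ?N = sets K" by simp
    ultimately show ?case by (intro exI[of _ ?N] conjI ballI impI)
  qed
  from this[of J] obtain N where N: "sets N = sets K"
      "\<And>i B. i \<in> I \<Longrightarrow> B \<in> sets K \<Longrightarrow> B \<subseteq> U i \<inter> (\<Union>j\<in>J. U j) \<Longrightarrow> emeasure N B = emeasure (M i) B"
    by (metis (no_types, lifting) subset_refl)
  have *: "B \<subseteq> U i \<inter> (\<Union>j\<in>J. U j)" if "B \<in> sets K" "B \<subseteq> U i" for i B
    using that J(3) sets.sets_into_space[OF that(1)] by blast
  show ?thesis by (intro exI[of _ N] conjI ballI impI N *)
qed

section \<open>Tensor fields on a closed manifold\<close>

text \<open>The tube lemma for filters. It is applied to the unit sphere and to the manifold, to get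
  positivity of nearby tensors and uniform convergence of difference quotients.\<close>

lemma eventually_ball_compact:
  assumes "compact K" and P: "\<And>p. p \<in> K \<Longrightarrow> eventually P (F \<times>\<^sub>F nhds p)"
  shows "eventually (\<lambda>u. \<forall>p\<in>K. P (u, p)) F"
proof -
  have "\<forall>p\<in>K. \<exists>Q S. eventually Q F \<and> open S \<and> p \<in> S \<and> (\<forall>u q. Q u \<longrightarrow> q \<in> S \<longrightarrow> P (u, q))"
  proof
    fix p assume "p \<in> K"
    from P[OF this] obtain Q R where "eventually Q F" "eventually R (nhds p)" "\<And>u q. Q u \<Longrightarrow> R q \<Longrightarrow> P (u, q)"
      unfolding eventually_prod_filter by auto
    then show "\<exists>Q S. eventually Q F \<and> open S \<and> p \<in> S \<and> (\<forall>u q. Q u \<longrightarrow> q \<in> S \<longrightarrow> P (u, q))"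
      unfolding eventually_nhds by metis
  qed
  then obtain Q S where QS: "\<And>p. p \<in> K \<Longrightarrow> eventually (Q p) F \<and> open (S p) \<and> p \<in> S p
      \<and> (\<forall>u q. Q p u \<longrightarrow> q \<in> S p \<longrightarrow> P (u, q))"
    by metis
  obtain L where L: "L \<subseteq> K" "finite L" "K \<subseteq> (\<Union>p\<in>L. S p)"
    by (rule compactE_image[OF \<open>compact K\<close>, of K S]) (use QS in auto)
  have "eventually (\<lambda>u. \<forall>p\<in>L. Q p u) F"
    using L QS by (intro eventually_ball_finite) auto
  then show ?thesis
    by eventually_elim (use L QS in blast)
qed

lemma tendsto_matrix_vector_mult:
  fixes f :: "'b \<Rightarrow> real^'n::finite^'m::finite"
  assumes "(f \<longlongrightarrow> A) F" "(g \<longlongrightarrow> v) F"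
  shows "((\<lambda>x. f x *v g x) \<longlongrightarrow> A *v v) F"
  unfolding matrix_vector_mult_def
  by (intro tendsto_vec_lambda tendsto_sum tendsto_mult tendsto_vec_nth assms)

section \<open>Linear combinations of smooth maps\<close>

lemma smooth_on_open: "smooth_on S f \<Longrightarrow> open S"
  by (simp add: smooth_on_def)

lemma smooth_on_differentiable: "smooth_on S f \<Longrightarrow> x \<in> S \<Longrightarrow> f differentiable (at x)"
  unfolding smooth_on_def by (metis iter_deriv.simps(1))

lemma iter_deriv_lincomb:
  assumes f: "smooth_on S f" and g: "smooth_on S g" and "x \<in> S"
  shows "iter_deriv vs (\<lambda>x. a *\<^sub>R f x + b *\<^sub>R g x) x = a *\<^sub>R iter_deriv vs f x + b *\<^sub>R iter_deriv vs g x
    \<and> iter_deriv vs (\<lambda>x. a *\<^sub>R f x + b *\<^sub>R g x) differentiable (at x)"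
  using \<open>x \<in> S\<close>
proof (induction vs arbitrary: x)
  \<comment> \<open>\<open>F\<close> is only known to agree with the combination on
    \<open>S\<close>. Agreement on the whole open set, and not just at \<open>x\<close>, is what
    allows the next derivative to be taken.\<close>
  have aux: "(F has_derivative (\<lambda>v. a *\<^sub>R frechet_derivative (iter_deriv vs f) (at x) v
      + b *\<^sub>R frechet_derivative (iter_deriv vs g) (at x) v)) (at x)"
    if "\<And>x. x \<in> S \<Longrightarrow> F x = a *\<^sub>R iter_deriv vs f x + b *\<^sub>R iter_deriv vs g x" "x \<in> S" for F vs x
  proof (rule has_derivative_transform_within_open[OF _ smooth_on_open[OF f] \<open>x \<in> S\<close>])
    have "iter_deriv vs f differentiable (at x)" "iter_deriv vs g differentiable (at x)"
      using f g that by (auto simp: smooth_on_def)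
    then show "((\<lambda>x. a *\<^sub>R iter_deriv vs f x + b *\<^sub>R iter_deriv vs g x) has_derivative
        (\<lambda>v. a *\<^sub>R frechet_derivative (iter_deriv vs f) (at x) v
      + b *\<^sub>R frechet_derivative (iter_deriv vs g) (at x) v)) (at x)"
      by (intro has_derivative_add has_derivative_scaleR_right) (auto simp: frechet_derivative_works[symmetric])
  qed (use that in auto)
  {
    case Nil
    then show ?case using aux[of "\<lambda>x. a *\<^sub>R f x + b *\<^sub>R g x" "[]"] by (auto simp: differentiable_def)
  next
    case (Cons v vs)
    have D: "iter_deriv (v # vs) (\<lambda>x. a *\<^sub>R f x + b *\<^sub>R g x) x =
      a *\<^sub>R iter_deriv (v # vs) f x + b *\<^sub>R iter_deriv (v # vs) g x" if "x \<in> S" for x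
      using frechet_derivative_at[OF aux[of "iter_deriv vs (\<lambda>x. a *\<^sub>R f x + b *\<^sub>R g x)" vs x]] Cons.IH that
      by (simp, metis)
    show ?case using aux[OF D Cons.prems] D[OF Cons.prems] unfolding differentiable_def by blast
  }
qed

lemma smooth_on_lincomb:
  "smooth_on S f \<Longrightarrow> smooth_on S g \<Longrightarrow> smooth_on S (\<lambda>x. a *\<^sub>R f x + b *\<^sub>R g x)"
  using iter_deriv_lincomb unfolding smooth_on_def by blast

text \<open>
  A change of chart conjugates \<open>g\<^sup>-\<^sup>1 h\<close> by the Jacobian, so that its trace and determinant are functions
  on the manifold.
\<close>

definition endo :: "('m, 'n::finite) tensor \<Rightarrow> ('m, 'n) tensor \<Rightarrow> ('m, 'n) chart \<Rightarrow> 'm \<Rightarrow> real^'n^'n" where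
  "endo g h c p = matrix_inv (g c p) ** h c p"

lemma matrix_mult_lincomb_right:
  fixes X :: "real^'n::finite^'m::finite"
  shows "X ** (a *\<^sub>R Y + b *\<^sub>R Z) = a *\<^sub>R (X ** Y) + b *\<^sub>R (X ** Z)"
  by (simp add: matrix_add_ldistrib matrix_scaleR_vector_ac matrix_matrix_mult_def vec_eq_iff
      sum_distrib_left sum.distrib algebra_simps)

lemma matrix_mult_lincomb_left:
  fixes X :: "real^'n::finite^'m::finite"
  shows "(a *\<^sub>R Y + b *\<^sub>R Z) ** X = a *\<^sub>R (Y ** X) + b *\<^sub>R (Z ** X)"
  by (simp add: matrix_matrix_mult_def vec_eq_iff sum_distrib_left sum.distrib algebra_simps)

lemma endo_lincomb:
  "endo g (a *\<^sub>T h + b *\<^sub>T k) c p = a *\<^sub>R endo g h c p + b *\<^sub>R endo g k c p"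
  by (simp add: endo_def tscale_def matrix_mult_lincomb_right)

section \<open>Charts, and tensor fields in charts\<close>

locale closed_mfd =
  fixes A :: "('m::t2_space, 'n::{finite,wellorder}) chart set"
  assumes closed_mfd: "closed_manifold A"
begin

lemma compact_UNIV: "compact (UNIV :: 'm set)"
  using closed_mfd by (simp add: closed_manifold_def)

lemma atlas: "smooth_atlas A"
  using closed_mfd by (simp add: closed_manifold_def)

lemma chart_at: "chart_at A p \<in> A" "p \<in> fst (chart_at A p)"
proof -
  have "\<exists>c. c \<in> A \<and> p \<in> fst c" using atlas unfolding smooth_atlas_def by blast
  then have "chart_at A p \<in> A \<and> p \<in> fst (chart_at A p)" unfolding chart_at_def by (rule someI_ex)
  then show "chart_at A p \<in> A" "p \<in> fst (chart_at A p)" by auto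
qed

lemma open_chart: "c \<in> A \<Longrightarrow> open (fst c)" "c \<in> A \<Longrightarrow> open (snd c ` fst c)"
  using atlas by (auto simp: smooth_atlas_def)

lemma chart_homeo: "c \<in> A \<Longrightarrow> homeomorphism (fst c) (snd c ` fst c) (snd c) (chart_inv c)"
  using atlas by (auto simp: smooth_atlas_def)

lemma chart_inv_left [simp]: "c \<in> A \<Longrightarrow> p \<in> fst c \<Longrightarrow> chart_inv c (snd c p) = p"
  using chart_homeo by (auto simp: homeomorphism_def)

lemma inj_on_chart: "c \<in> A \<Longrightarrow> inj_on (snd c) (fst c)"
  by (metis chart_inv_left inj_onI)

lemma eventually_chart: "c \<in> A \<Longrightarrow> p \<in> fst c \<Longrightarrow> eventually (\<lambda>q. q \<in> fst c) (nhds p)"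
  using open_chart(1) eventually_nhds by blast

lemma tendsto_chart: "c \<in> A \<Longrightarrow> p \<in> fst c \<Longrightarrow> (snd c \<longlongrightarrow> snd c p) (nhds p)"
  using chart_homeo open_chart(1)
  by (metis continuous_on_eq_continuous_at homeomorphism_def isCont_def tendsto_nhds_iff)

lemma transition_smooth: "c \<in> A \<Longrightarrow> d \<in> A \<Longrightarrow> smooth_on (snd c ` (fst c \<inter> fst d)) (transition c d)"
  using atlas by (auto simp: smooth_atlas_def)

lemma tensor_transform:
  "h \<in> sym_tensor_fields A \<Longrightarrow> c \<in> A \<Longrightarrow> d \<in> A \<Longrightarrow> p \<in> fst c \<Longrightarrow> p \<in> fst d \<Longrightarrow>
    h c p = transpose (jacobian c d p) ** h d p ** jacobian c d p"
  unfolding sym_tensor_fields_def by blast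

lemma tensor_smooth: "h \<in> sym_tensor_fields A \<Longrightarrow> c \<in> A \<Longrightarrow> smooth_on (snd c ` fst c) (components h c)"
  unfolding sym_tensor_fields_def by blast

lemma tensor_off: "h \<in> sym_tensor_fields A \<Longrightarrow> \<not> (c \<in> A \<and> p \<in> fst c) \<Longrightarrow> h c p = 0"
  unfolding sym_tensor_fields_def by blast

lemma tensor_sym: "h \<in> sym_tensor_fields A \<Longrightarrow> c \<in> A \<Longrightarrow> p \<in> fst c \<Longrightarrow> transpose (h c p) = h c p"
  unfolding sym_tensor_fields_def by blast

lemma tensor_eqI:
  assumes "h \<in> sym_tensor_fields A" "k \<in> sym_tensor_fields A"
    and "\<And>c p. c \<in> A \<Longrightarrow> p \<in> fst c \<Longrightarrow> h c p = k c p"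
  shows "h = k"
proof (intro ext)
  fix c p
  show "h c p = k c p"
    using assms(3)[of c p] tensor_off[OF assms(1)] tensor_off[OF assms(2)]
    by (cases "c \<in> A \<and> p \<in> fst c") simp_all
qed

lemma components_chart: "c \<in> A \<Longrightarrow> p \<in> fst c \<Longrightarrow> components h c (snd c p) = h c p"
  by (simp add: components_def)

text \<open>Stated with \<open>nhds p\<close>, so that it composes with the projection of a product
  filter onto the base point, which may equal \<open>p\<close>.\<close>

lemma tendsto_tensor:
  assumes "h \<in> sym_tensor_fields A" "c \<in> A" "p \<in> fst c"
  shows "(h c \<longlongrightarrow> h c p) (nhds p)"
proof -
  have "isCont (components h c) (snd c p)"
    using smooth_on_differentiable[OF tensor_smooth] assms by (blast intro: differentiable_imp_continuous_within)
  then have "((\<lambda>q. components h c (snd c q)) \<longlongrightarrow> components h c (snd c p)) (nhds p)"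
    using tendsto_chart[OF assms(2,3)] by (rule isCont_tendsto_compose)
  moreover have "eventually (\<lambda>q. components h c (snd c q) = h c q) (nhds p)"
    using eventually_chart[OF assms(2,3)] by eventually_elim (simp add: components_chart assms)
  ultimately show ?thesis
    using Lim_transform_eventually components_chart assms by metis
qed

lemma lincomb_in_sym:
  assumes h: "h \<in> sym_tensor_fields A" and k: "k \<in> sym_tensor_fields A"
  shows "a *\<^sub>T h + b *\<^sub>T k \<in> sym_tensor_fields A"
proof -
  have "components (a *\<^sub>T h + b *\<^sub>T k) c = (\<lambda>x. a *\<^sub>R components h c x + b *\<^sub>R components k c x)" for c
    by (simp add: components_def tscale_def fun_eq_iff)
  then have "smooth_on (snd c ` fst c) (components (a *\<^sub>T h + b *\<^sub>T k) c)" if "c \<in> A" for c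
    using smooth_on_lincomb[OF tensor_smooth[OF h that] tensor_smooth[OF k that]] by simp
  moreover have "(a *\<^sub>T h + b *\<^sub>T k) c p = transpose (jacobian c d p) ** (a *\<^sub>T h + b *\<^sub>T k) d p ** jacobian c d p"
    if "c \<in> A" "d \<in> A" "p \<in> fst c \<inter> fst d" for c d p
    using tensor_transform[OF h, of c d p] tensor_transform[OF k, of c d p] that
    by (simp add: tscale_def matrix_mult_lincomb_left matrix_mult_lincomb_right)
  moreover have "transpose ((a *\<^sub>T h + b *\<^sub>T k) c p) = (a *\<^sub>T h + b *\<^sub>T k) c p" if "c \<in> A" "p \<in> fst c" for c p
  proof -
    have "transpose (h c p) = h c p" "transpose (k c p) = k c p"
      using tensor_sym h k that by blast+
    then show ?thesis by (simp add: tscale_def transpose_def vec_eq_iff)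
  qed
  moreover have "(a *\<^sub>T h + b *\<^sub>T k) c p = 0" if "\<not> (c \<in> A \<and> p \<in> fst c)" for c p
    using tensor_off[OF h that] tensor_off[OF k that] by (simp add: tscale_def)
  ultimately show ?thesis unfolding sym_tensor_fields_def by blast
qed

lemma
  assumes h: "h \<in> sym_tensor_fields A"
  shows scale_in_sym: "a *\<^sub>T h \<in> sym_tensor_fields A" and zero_in_sym: "0 \<in> sym_tensor_fields A"
proof -
  have "a *\<^sub>T h + 0 *\<^sub>T h = a *\<^sub>T h" "0 *\<^sub>T h + 0 *\<^sub>T h = 0"
    by (auto simp: tscale_def fun_eq_iff)
  then show "a *\<^sub>T h \<in> sym_tensor_fields A" "0 \<in> sym_tensor_fields A"
    using lincomb_in_sym[OF h h] by metis+
qed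

section \<open>Riemannian metrics under change of chart, and openness of the space of
  metrics\<close>

lemma metric_in_sym: "g \<in> riem_metrics A \<Longrightarrow> g \<in> sym_tensor_fields A"
  by (simp add: riem_metrics_def)

lemma metric_det_pos: "g \<in> riem_metrics A \<Longrightarrow> c \<in> A \<Longrightarrow> p \<in> fst c \<Longrightarrow> det (g c p) > 0"
  by (rule pos_def_det_pos) (simp add: riem_metrics_def)

lemma metric_det_transform:
  assumes "g \<in> riem_metrics A" "c \<in> A" "d \<in> A" "p \<in> fst c" "p \<in> fst d"
  shows "det (g c p) = (det (jacobian c d p))\<^sup>2 * det (g d p)"
  using tensor_transform[OF metric_in_sym[OF assms(1)] assms(2-5)]
  by (simp add: det_mul power2_eq_square)

text \<open>The metric itself shows this: its determinants in the two charts are positive and differ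
  by the square of the Jacobian determinant. This replaces a chain rule argument with the inverse
  transition map.\<close>

lemma jacobian_det_nz:
  assumes "g \<in> riem_metrics A" "c \<in> A" "d \<in> A" "p \<in> fst c" "p \<in> fst d"
  shows "det (jacobian c d p) \<noteq> 0"
  using metric_det_transform[OF assms] metric_det_pos[OF assms(1,2,4)] by auto

lemma endo_transform:
  assumes g: "g \<in> riem_metrics A" and h: "h \<in> sym_tensor_fields A"
    and c: "c \<in> A" "d \<in> A" "p \<in> fst c" "p \<in> fst d"
  shows "endo g h c p = matrix_inv (jacobian c d p) ** endo g h d p ** jacobian c d p"
proof -
  let ?J = "jacobian c d p" and ?g = "g d p"
  note J = matrix_inv_right[OF jacobian_det_nz[OF g c]] matrix_inv_left[OF jacobian_det_nz[OF g c]]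
  have g_nz: "det ?g \<noteq> 0" using metric_det_pos[OF g c(2) c(4)] by simp
  note G = matrix_inv_right[OF g_nz] matrix_inv_left[OF g_nz]
  have JT: "transpose ?J ** transpose (matrix_inv ?J) = mat 1"
    by (simp only: matrix_transpose_mul[symmetric] J transpose_mat)
  have JT2: "transpose (matrix_inv ?J) ** transpose ?J = mat 1"
    by (simp only: matrix_transpose_mul[symmetric] J transpose_mat)
  have "(transpose ?J ** ?g ** ?J) ** (matrix_inv ?J ** matrix_inv ?g ** transpose (matrix_inv ?J)) =
      transpose ?J ** (?g ** (?J ** matrix_inv ?J) ** matrix_inv ?g) ** transpose (matrix_inv ?J)"
    by (simp only: matrix_mul_assoc)
  also have "\<dots> = mat 1" by (simp add: J G JT)
  finally have "matrix_inv (g c p) = matrix_inv ?J ** matrix_inv ?g ** transpose (matrix_inv ?J)"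
    using tensor_transform[OF metric_in_sym[OF g] c] by (simp add: matrix_inv_eqI)
  then have "endo g h c p =
      matrix_inv ?J ** matrix_inv ?g ** (transpose (matrix_inv ?J) ** transpose ?J) ** h d p ** ?J"
    by (simp add: endo_def tensor_transform[OF h c] matrix_mul_assoc)
  then show ?thesis by (simp add: JT2 endo_def matrix_mul_assoc)
qed

lemma endo_invariants:
  assumes g: "g \<in> riem_metrics A" and h: "h \<in> sym_tensor_fields A" and k: "k \<in> sym_tensor_fields A"
    and c: "c \<in> A" "d \<in> A" "p \<in> fst c" "p \<in> fst d"
  shows "trace (endo g h c p) = trace (endo g h d p)" "det (endo g h c p) = det (endo g h d p)"
    "trace (endo g h c p ** endo g k c p) = trace (endo g h d p ** endo g k d p)"
proof -
  let ?J = "jacobian c d p"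
  note J = matrix_inv_right[OF jacobian_det_nz[OF g c]] matrix_inv_left[OF jacobian_det_nz[OF g c]]
  have tr: "trace (matrix_inv ?J ** X ** ?J) = trace X" for X
    using trace_mul_sym[of "matrix_inv ?J" "X ** ?J"] by (simp add: matrix_mul_assoc[symmetric] J)
  have "det (matrix_inv ?J) * det ?J = 1" by (simp only: det_mul[symmetric] J det_I)
  then show "det (endo g h c p) = det (endo g h d p)"
    by (simp add: endo_transform[OF g h c] det_mul)
  show "trace (endo g h c p) = trace (endo g h d p)"
    by (simp add: endo_transform[OF g h c] tr)
  have "endo g h c p ** endo g k c p =
    matrix_inv ?J ** endo g h d p ** (?J ** matrix_inv ?J) ** endo g k d p ** ?J"
    by (simp only: endo_transform[OF g h c] endo_transform[OF g k c] matrix_mul_assoc)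
  also have "\<dots> = matrix_inv ?J ** (endo g h d p ** endo g k d p) ** ?J"
    by (simp add: J matrix_mul_assoc)
  finally show "trace (endo g h c p ** endo g k c p) = trace (endo g h d p ** endo g k d p)"
    by (simp add: tr)
qed

lemma endo_self:
  assumes "g \<in> riem_metrics A" "c \<in> A" "p \<in> fst c"
  shows "endo g g c p = mat 1"
  using matrix_inv_left[of "g c p"] metric_det_pos[OF assms] by (simp add: endo_def)

lemma tendsto_endo:
  assumes "g \<in> riem_metrics A" "h \<in> sym_tensor_fields A" "c \<in> A" "p \<in> fst c"
  shows "(endo g h c \<longlongrightarrow> endo g h c p) (nhds p)"
  unfolding endo_def[abs_def] using metric_det_pos[OF assms(1,3,4)]
  by (intro tendsto_matrix_matrix_mult tendsto_matrix_inv tendsto_tensor assms metric_in_sym) auto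

text \<open>Openness along lines, so that for small parameters \<open>dir_deriv\<close> meets only
  metrics. Positivity is a strict inequality over the unit vectors at all points, and the tube lemma
  is applied twice: over the unit sphere and then over the manifold.\<close>

lemma eventually_metric:
  assumes g: "g \<in> riem_metrics A" and h: "h \<in> sym_tensor_fields A"
  shows "eventually (\<lambda>s. g + s *\<^sub>T h \<in> riem_metrics A) (nhds 0)"
proof -
  let ?q = "\<lambda>s c p v. v \<bullet> ((g c p + s *\<^sub>R h c p) *v v)"
  \<comment> \<open>One chart per point is all that can be controlled near a given point; the
    remaining charts follow by the transformation rule below.\<close>
  have "eventually (\<lambda>s. \<forall>p\<in>UNIV. (\<lambda>(s, p). \<exists>c\<in>A. p \<in> fst c \<and> (\<forall>v\<in>sphere 0 1. ?q s c p v > 0)) (s, p)) (nhds (0::real))"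
  proof (rule eventually_ball_compact[OF compact_UNIV])
    fix p :: 'm
    let ?c = "chart_at A p"
    note c = chart_at[of p]
    let ?F = "nhds (0::real) \<times>\<^sub>F nhds p"
    have "eventually (\<lambda>sp. \<forall>v\<in>sphere 0 1. (\<lambda>(sp, v). ?q (fst sp) ?c (snd sp) v > 0) (sp, v)) ?F"
    proof (rule eventually_ball_compact)
      fix v :: "real^'n::_" assume "v \<in> sphere 0 1"
      then have v: "v \<noteq> 0" by auto
      have s: "((\<lambda>x. fst (fst x)) \<longlongrightarrow> 0) (?F \<times>\<^sub>F nhds v)"
        and p: "filterlim (\<lambda>x. snd (fst x)) (nhds p) (?F \<times>\<^sub>F nhds v)"
        and v': "(snd \<longlongrightarrow> v) (?F \<times>\<^sub>F nhds v)"
        by (auto intro: filterlim_compose filterlim_fst filterlim_snd)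
      have "((\<lambda>x. ?q (fst (fst x)) ?c (snd (fst x)) (snd x)) \<longlongrightarrow> ?q 0 ?c p v) (?F \<times>\<^sub>F nhds v)"
        by (intro tendsto_inner tendsto_matrix_vector_mult tendsto_add tendsto_scaleR s v'
            filterlim_compose[OF tendsto_tensor p] metric_in_sym g h c)
      moreover have "?q 0 ?c p v > 0" using g c v by (simp add: riem_metrics_def)
      ultimately show "eventually (\<lambda>(sp, v). ?q (fst sp) ?c (snd sp) v > 0) (?F \<times>\<^sub>F nhds v)"
        unfolding case_prod_unfold by (rule order_tendstoD(1))
    qed simp
    moreover have "eventually (\<lambda>sp. snd sp \<in> fst ?c) ?F"
      by (rule eventually_compose_filterlim[OF eventually_chart[OF c] filterlim_snd])
    ultimately show "eventually (\<lambda>(s, p). \<exists>c\<in>A. p \<in> fst c \<and> (\<forall>v\<in>sphere 0 1. ?q s c p v > 0)) ?F"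
      by eventually_elim (use c in auto)
  qed
  then show ?thesis
  proof eventually_elim
    case (elim s)
    let ?g = "1 *\<^sub>T g + s *\<^sub>T h"
    have eq: "g + s *\<^sub>T h = ?g" by (simp add: tscale_def)
    have g': "?g \<in> sym_tensor_fields A" by (rule lincomb_in_sym[OF metric_in_sym[OF g] h])
    \<comment> \<open>The vector \<open>v\<close> in the chart \<open>d\<close> becomes
      \<open>?J *v v\<close> in the good chart \<open>c\<close>; it is non-zero and can be
      normalised to the unit sphere.\<close>
    have "v \<bullet> (?g d p *v v) > 0" if d: "d \<in> A" "p \<in> fst d" and v: "v \<noteq> 0" for d p v
    proof -
      obtain c where c: "c \<in> A" "p \<in> fst c" and "\<forall>v\<in>sphere 0 1. ?q s c p v > 0"
        using elim by blast
      then have pos: "v \<bullet> (?g c p *v v) > 0" if "norm v = 1" for v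
        using that by (simp add: tscale_def)
      let ?J = "jacobian d c p"
      let ?w = "?J *v v"
      have "?w \<noteq> 0"
      proof
        assume "?w = 0"
        then have "(matrix_inv ?J ** ?J) *v v = 0" by (simp add: matrix_vector_mul_assoc[symmetric])
        with v show False
          using matrix_inv_left[OF jacobian_det_nz[OF g d(1) c(1) d(2) c(2)]] by simp
      qed
      then have w: "norm ?w > 0" and "norm ((1 / norm ?w) *\<^sub>R ?w) = 1" by auto
      then have "((1 / norm ?w) *\<^sub>R ?w) \<bullet> (?g c p *v ((1 / norm ?w) *\<^sub>R ?w)) > 0" by (intro pos)
      then have "(1 / norm ?w) * ((1 / norm ?w) * (?w \<bullet> (?g c p *v ?w))) > 0"
        by (simp add: matrix_vector_mult_scaleR)
      then have "?w \<bullet> (?g c p *v ?w) > 0" using w by (auto simp: zero_less_mult_iff zero_less_divide_iff)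
      also have "?w \<bullet> (?g c p *v ?w) = v \<bullet> (transpose ?J *v (?g c p *v ?w))"
        by (metis dot_lmul_matrix inner_commute transpose_matrix_vector)
      also have "\<dots> = v \<bullet> ((transpose ?J ** ?g c p ** ?J) *v v)"
        by (simp only: matrix_vector_mul_assoc matrix_mul_assoc)
      also have "transpose ?J ** ?g c p ** ?J = ?g d p"
        by (rule tensor_transform[OF g' d(1) c(1) d(2) c(2), symmetric])
      finally show ?thesis .
    qed
    with g' show ?case unfolding eq by (simp add: riem_metrics_def)
  qed
qed

end

section \<open>The Riemannian volume\<close>

lemma nn_integral_cong_subsets:
  assumes M: "sets M = sets K" and N: "sets N = sets K" and U: "U \<in> sets K" and f: "f \<in> borel_measurable K"
    and eq: "\<And>B. B \<in> sets K \<Longrightarrow> B \<subseteq> U \<Longrightarrow> emeasure M B = emeasure N B"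
  shows "(\<integral>\<^sup>+x\<in>U. f x \<partial>M) = (\<integral>\<^sup>+x\<in>U. f x \<partial>N)"
proof -
  \<comment> \<open>The density by the indicator serves as the restriction to \<open>U\<close>,
    since it keeps the underlying space and sigma-algebra.\<close>
  have "density M (indicator U) = density N (indicator U)"
  proof (rule measure_eqI)
    fix B assume "B \<in> sets (density M (indicator U))"
    then have B: "B \<in> sets K" by (simp add: M)
    have "emeasure (density L (indicator U)) B = emeasure L (U \<inter> B)" if "sets L = sets K" for L
      using B U that by (simp add: emeasure_restricted)
    then show "emeasure (density M (indicator U)) B = emeasure (density N (indicator U)) B"
      using M N B U by (simp add: eq)
  qed (simp add: M N)
  moreover have "(\<integral>\<^sup>+x. f x \<partial>density L (indicator U)) = (\<integral>\<^sup>+x\<in>U. f x \<partial>L)" if "sets L = sets K" for L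
  proof -
    have "f \<in> borel_measurable L" "indicator U \<in> borel_measurable L"
      using f U measurable_cong_sets[OF that refl] that by auto
    then show ?thesis by (subst nn_integral_density) (auto simp: mult.commute)
  qed
  ultimately show ?thesis using M N by metis
qed

section \<open>The volume measure of a single chart\<close>

context closed_mfd
begin

definition chart_density :: "('m, 'n) tensor \<Rightarrow> ('m, 'n) chart \<Rightarrow> real^'n::_ \<Rightarrow> real" where
  "chart_density g c x = (if x \<in> snd c ` fst c then sqrt (det (components g c x)) else 0)"

text \<open>An explicit constant off the image of the chart gives the case distinction from which
  Borel measurability on the whole space is read off. Its value is harmless, because
  \<open>chart_density\<close> vanishes there.\<close>

definition chart_inv_total :: "('m, 'n) chart \<Rightarrow> real^'n::_ \<Rightarrow> 'm" where
  "chart_inv_total c x = (if x \<in> snd c ` fst c then chart_inv c x else undefined)"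

definition chart_measure :: "('m, 'n) tensor \<Rightarrow> ('m, 'n) chart \<Rightarrow> 'm measure" where
  "chart_measure g c = distr (density lborel (\<lambda>x. ennreal (chart_density g c x))) borel (chart_inv_total c)"

lemma chart_density_nonneg: "g \<in> riem_metrics A \<Longrightarrow> c \<in> A \<Longrightarrow> 0 \<le> chart_density g c x"
  using metric_det_pos[of g c] by (auto simp: chart_density_def components_chart less_imp_le)

lemma chart_density_chart:
  "c \<in> A \<Longrightarrow> p \<in> fst c \<Longrightarrow> chart_density g c (snd c p) = sqrt (det (g c p))"
  by (simp add: chart_density_def components_chart)

lemma continuous_on_components:
  "h \<in> sym_tensor_fields A \<Longrightarrow> c \<in> A \<Longrightarrow> continuous_on (snd c ` fst c) (components h c)"
  using smooth_on_differentiable[OF tensor_smooth]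
  by (intro continuous_at_imp_continuous_on ballI differentiable_imp_continuous_within) auto

lemma borel_measurable_chart_density:
  assumes "g \<in> riem_metrics A" "c \<in> A"
  shows "chart_density g c \<in> borel_measurable borel"
  unfolding chart_density_def[abs_def]
proof (rule borel_measurable_continuous_on_if)
  show "snd c ` fst c \<in> sets borel" using open_chart(2)[OF assms(2)] by auto
  show "continuous_on (snd c ` fst c) (\<lambda>x. sqrt (det (components g c x)))"
    using continuous_on_components[OF metric_in_sym[OF assms(1)] assms(2)]
    unfolding continuous_on_def by (intro ballI tendsto_real_sqrt tendsto_det) auto
qed auto

lemma borel_measurable_chart_inv_total:
  assumes "c \<in> A"
  shows "chart_inv_total c \<in> borel_measurable borel"
  unfolding chart_inv_total_def[abs_def]
proof (rule borel_measurable_continuous_on_if)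
  show "snd c ` fst c \<in> sets borel" using open_chart(2)[OF assms] by auto
  show "continuous_on (snd c ` fst c) (chart_inv c)"
    using chart_homeo[OF assms] by (simp add: homeomorphism_def)
qed auto

lemma sets_chart_measure: "sets (chart_measure g c) = sets borel"
  by (simp add: chart_measure_def)

lemma nn_integral_chart_measure:
  assumes "g \<in> riem_metrics A" "c \<in> A" "f \<in> borel_measurable borel"
  shows "(\<integral>\<^sup>+p. f p \<partial>chart_measure g c) =
    (\<integral>\<^sup>+x. ennreal (chart_density g c x) * f (chart_inv_total c x) \<partial>lborel)"
proof -
  note [measurable] = borel_measurable_chart_inv_total[OF assms(2)]
    borel_measurable_chart_density[OF assms(1,2)] assms(3)
  show ?thesis
    unfolding chart_measure_def by (subst nn_integral_distr, simp, simp, subst nn_integral_density) auto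
qed

text \<open>The image under a chart is a preimage under the inverse chart, which is Borel
  measurable.\<close>

lemma borel_chart_image:
  assumes "c \<in> A" "B \<in> sets borel" "B \<subseteq> fst c"
  shows "snd c ` B \<in> sets borel"
proof -
  have "snd c ` B = (chart_inv_total c -` B \<inter> space borel) \<inter> snd c ` fst c"
  proof (intro set_eqI iffI)
    fix x assume "x \<in> snd c ` B"
    then obtain p where "p \<in> B" "p \<in> fst c" "x = snd c p" using assms(3) by blast
    then show "x \<in> chart_inv_total c -` B \<inter> space borel \<inter> snd c ` fst c"
      using assms(1) by (simp add: chart_inv_total_def)
  next
    fix x assume x: "x \<in> chart_inv_total c -` B \<inter> space borel \<inter> snd c ` fst c"
    then obtain p where "p \<in> fst c" "x = snd c p" by blast
    with x assms(1) show "x \<in> snd c ` B" by (simp add: chart_inv_total_def)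
  qed
  moreover have "chart_inv_total c -` B \<inter> space borel \<in> sets borel"
    by (rule measurable_sets[OF borel_measurable_chart_inv_total[OF assms(1)] assms(2)])
  moreover have "snd c ` fst c \<in> sets borel" using open_chart(2)[OF assms(1)] by auto
  ultimately show ?thesis by auto
qed

lemma nn_integral_chart_measure_subset:
  assumes "g \<in> riem_metrics A" "c \<in> A" "f \<in> borel_measurable borel" "B \<in> sets borel" "B \<subseteq> fst c"
  shows "(\<integral>\<^sup>+p\<in>B. f p \<partial>chart_measure g c) =
    (\<integral>\<^sup>+x\<in>snd c ` B. ennreal (sqrt (det (components g c x))) * f (chart_inv c x) \<partial>lborel)"
proof -
  have "(\<integral>\<^sup>+p\<in>B. f p \<partial>chart_measure g c) =
      (\<integral>\<^sup>+x. ennreal (chart_density g c x) * (f (chart_inv_total c x) * indicator B (chart_inv_total c x)) \<partial>lborel)"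
    using assms by (intro nn_integral_chart_measure) auto
  also have "\<dots> = (\<integral>\<^sup>+x\<in>snd c ` B. ennreal (sqrt (det (components g c x))) * f (chart_inv c x) \<partial>lborel)"
  proof (intro nn_integral_cong)
    fix x
    show "ennreal (chart_density g c x) * (f (chart_inv_total c x) * indicator B (chart_inv_total c x)) =
      ennreal (sqrt (det (components g c x))) * f (chart_inv c x) * indicator (snd c ` B) x"
    proof (cases "x \<in> snd c ` fst c")
      case True
      then obtain p where p: "p \<in> fst c" "x = snd c p" by auto
      have "x \<in> snd c ` B \<longleftrightarrow> p \<in> B"
        using p assms(5) inj_onD[OF inj_on_chart[OF assms(2)]] by auto
      then show ?thesis
        using p assms(2) by (simp add: chart_density_def chart_inv_total_def indicator_def)
    next
      case False
      then have "x \<notin> snd c ` B" using assms(5) by auto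
      with False show ?thesis by (simp add: chart_density_def)
    qed
  qed
  finally show ?thesis .
qed

lemma emeasure_chart_measure:
  assumes "g \<in> riem_metrics A" "c \<in> A" "B \<in> sets borel" "B \<subseteq> fst c"
  shows "emeasure (chart_measure g c) B = (\<integral>\<^sup>+x\<in>snd c ` B. ennreal (sqrt (det (components g c x))) \<partial>lborel)"
  using nn_integral_chart_measure_subset[OF assms(1,2) _ assms(3,4), of "\<lambda>_. 1"] assms(3)
  by (simp add: sets_chart_measure)

text \<open>The determinant of the metric changes by the square of the Jacobian determinant, so its
  root changes by the absolute value, which is the factor in the change of variables
  formula.\<close>

lemma chart_measure_agree:
  assumes g: "g \<in> riem_metrics A" and c: "c \<in> A" and d: "d \<in> A"
    and B: "B \<in> sets borel" "B \<subseteq> fst c \<inter> fst d"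
  shows "emeasure (chart_measure g c) B = emeasure (chart_measure g d) B"
proof -
  define S where "S = snd c ` B"
  let ?T = "transition c d"
  let ?T' = "\<lambda>x. frechet_derivative ?T (at x)"
  let ?f = "\<lambda>y. chart_density g d y * indicator (snd d ` B) y"
  let ?h = "\<lambda>x. chart_density g c x * indicator (snd c ` B) x"
  have Bc: "B \<subseteq> fst c" and Bd: "B \<subseteq> fst d" using B by auto
  have T: "?T (snd c p) = snd d p" if "p \<in> B" for p
    using that Bc c by (auto simp: transition_def)
  have TS: "?T ` S = snd d ` B"
    unfolding S_def image_image using T by (auto intro: image_cong)
  have borel: "snd c ` B \<in> sets borel" "snd d ` B \<in> sets borel"
    using borel_chart_image B Bc Bd c d by auto
  have eq: "emeasure (chart_measure g e) B = (\<integral>\<^sup>+x. ennreal (chart_density g e x * indicator (snd e ` B) x) \<partial>lborel)"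
    if e: "e \<in> A" "B \<subseteq> fst e" for e
    unfolding emeasure_chart_measure[OF g e(1) B(1) e(2)] using e
    by (intro nn_integral_cong) (auto simp: chart_density_def indicator_def subset_iff)
  have "(\<integral>\<^sup>+x. ennreal (?h x) \<partial>lborel) = (\<integral>\<^sup>+x. ennreal (?f x) \<partial>lborel)"
  proof (rule nn_integral_change_of_variables[where T = ?T and T' = ?T' and S = S])
    show "S \<in> sets borel" using borel by (simp add: S_def)
    show "(?T has_derivative ?T' x) (at x within S)" if "x \<in> S" for x
    proof -
      have "x \<in> snd c ` (fst c \<inter> fst d)" using that B by (auto simp: S_def)
      then have "?T differentiable (at x)"
        using smooth_on_differentiable[OF transition_smooth[OF c d]] by blast
      then show ?thesis by (simp add: frechet_derivative_works has_derivative_at_withinI)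
    qed
    show "inj_on ?T S"
    proof (rule inj_onI)
      fix x y assume "x \<in> S" "y \<in> S" "?T x = ?T y"
      then obtain p q where "p \<in> B" "q \<in> B" "x = snd c p" "y = snd c q" "snd d p = snd d q"
        using T by (auto simp: S_def)
      then show "x = y" using inj_onD[OF inj_on_chart[OF d]] Bd by blast
    qed
    show "?f \<in> borel_measurable borel" "?h \<in> borel_measurable borel"
      using borel borel_measurable_chart_density[OF g] c d by auto
    show "0 \<le> ?f x" for x using chart_density_nonneg[OF g d] by simp
    show "?f y = 0" if "y \<notin> ?T ` S" for y using that by (simp add: TS)
    show "?h x = 0" if "x \<notin> S" for x using that by (simp add: S_def)
    show "?h x = \<bar>det (matrix (?T' x))\<bar> * ?f (?T x)" if x: "x \<in> S" for x
    proof -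
      obtain p where p: "p \<in> B" "x = snd c p" using x by (auto simp: S_def)
      have pc: "p \<in> fst c" "p \<in> fst d" using p B by auto
      have "sqrt (det (g c p)) = \<bar>det (jacobian c d p)\<bar> * sqrt (det (g d p))"
        using metric_det_transform[OF g c d pc] by (simp add: real_sqrt_mult)
      moreover have "matrix (?T' x) = jacobian c d p" by (simp add: jacobian_def p)
      ultimately show ?thesis
        using p pc by (simp add: T chart_density_chart c d)
    qed
  qed
  then show ?thesis using eq c d Bc Bd by simp
qed

section \<open>Existence, uniqueness, finiteness and positivity of the Riemannian volume\<close>

lemma finite_chart_cover: "\<exists>J\<subseteq>A. finite J \<and> (\<Union>c\<in>J. fst c) = UNIV"
proof -
  have cover: "UNIV \<subseteq> (\<Union>c\<in>A. fst c)" using atlas by (simp add: smooth_atlas_def)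
  obtain J where "J \<subseteq> A" "finite J" "UNIV \<subseteq> (\<Union>c\<in>J. fst c)"
    by (rule compactE_image[OF compact_UNIV open_chart(1) cover])
  then show ?thesis by auto
qed

lemma is_riem_volume_unique:
  assumes "is_riem_volume A g M" "is_riem_volume A g N"
  shows "M = N"
proof -
  obtain J where J: "J \<subseteq> A" "finite J" "(\<Union>c\<in>J. fst c) = UNIV" using finite_chart_cover by (elim exE conjE)
  show ?thesis
  proof (rule emeasure_eq_on_coverI[where K = borel and U = fst and J = J])
    show "fst c \<in> sets borel" if "c \<in> J" for c by (intro borel_open open_chart(1) subsetD[OF J(1) that])
    show "emeasure M B = emeasure N B" if "c \<in> J" "B \<in> sets borel" "B \<subseteq> fst c" for c B
      using assms that(2,3) subsetD[OF J(1) that(1)] by (simp add: is_riem_volume_def)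
  qed (use J assms in \<open>simp_all add: is_riem_volume_def\<close>)
qed

text \<open>\<open>riem_volume\<close> is a definite description, so a measure with the required
  values has to be exhibited: the chart measures are glued along a finite subcover.\<close>

lemma is_riem_volume_exists:
  assumes g: "g \<in> riem_metrics A"
  shows "\<exists>M. is_riem_volume A g M"
proof -
  obtain J where J: "J \<subseteq> A" "finite J" "(\<Union>c\<in>J. fst c) = UNIV" using finite_chart_cover by (elim exE conjE)
  have "\<exists>N. sets N = sets borel \<and> (\<forall>c\<in>A. \<forall>B\<in>sets borel. B \<subseteq> fst c \<longrightarrow> emeasure N B = emeasure (chart_measure g c) B)"
  proof (rule glue_measures[where J = J])
    show "fst c \<in> sets borel" if "c \<in> A" for c using open_chart(1)[OF that] by auto
    show "emeasure (chart_measure g c) B = emeasure (chart_measure g d) B"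
      if "c \<in> A" "d \<in> A" "B \<in> sets borel" "B \<subseteq> fst c \<inter> fst d" for c d B
      by (rule chart_measure_agree[OF g that])
  qed (use J sets_chart_measure in auto)
  then obtain N where "sets N = sets borel"
    and "\<And>c B. c \<in> A \<Longrightarrow> B \<in> sets borel \<Longrightarrow> B \<subseteq> fst c \<Longrightarrow> emeasure N B = emeasure (chart_measure g c) B"
    by blast
  then show ?thesis
    unfolding is_riem_volume_def using emeasure_chart_measure[OF g] by (intro exI[of _ N]) simp
qed

lemma riem_volume_eqI: "is_riem_volume A g M \<Longrightarrow> riem_volume A g = M"
  unfolding riem_volume_def using is_riem_volume_unique by blast

lemma riem_volume:
  assumes "g \<in> riem_metrics A"
  shows "is_riem_volume A g (riem_volume A g)"
  using is_riem_volume_exists[OF assms] riem_volume_eqI by metis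

lemma sets_riem_volume: "g \<in> riem_metrics A \<Longrightarrow> sets (riem_volume A g) = sets borel"
  using riem_volume by (simp add: is_riem_volume_def)

lemma space_riem_volume: "g \<in> riem_metrics A \<Longrightarrow> space (riem_volume A g) = UNIV"
  using sets_eq_imp_space_eq[OF sets_riem_volume] by simp

lemma emeasure_riem_volume:
  assumes "g \<in> riem_metrics A" "c \<in> A" "B \<in> sets borel" "B \<subseteq> fst c"
  shows "emeasure (riem_volume A g) B = (\<integral>\<^sup>+x\<in>snd c ` B. ennreal (sqrt (det (components g c x))) \<partial>lborel)"
  using riem_volume[OF assms(1)] assms(2-4) unfolding is_riem_volume_def by blast

lemma nn_integral_riem_volume:
  assumes g: "g \<in> riem_metrics A" and c: "c \<in> A" and f: "f \<in> borel_measurable borel"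
    and B: "B \<in> sets borel" "B \<subseteq> fst c"
  shows "(\<integral>\<^sup>+p\<in>B. f p \<partial>riem_volume A g) =
    (\<integral>\<^sup>+x\<in>snd c ` B. ennreal (sqrt (det (components g c x))) * f (chart_inv c x) \<partial>lborel)"
proof -
  have "(\<integral>\<^sup>+p\<in>B. f p \<partial>riem_volume A g) = (\<integral>\<^sup>+p\<in>B. f p \<partial>chart_measure g c)"
  proof (rule nn_integral_cong_subsets[where K = borel])
    fix C :: "'m set" assume C: "C \<in> sets borel" "C \<subseteq> B"
    then have "C \<subseteq> fst c" using B(2) by blast
    then show "emeasure (riem_volume A g) C = emeasure (chart_measure g c) C"
      using emeasure_riem_volume[OF g c C(1)] emeasure_chart_measure[OF g c C(1)] by simp
  qed (use f B sets_riem_volume[OF g] sets_chart_measure in auto)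
  then show ?thesis using nn_integral_chart_measure_subset[OF g c f B] by simp
qed

text \<open>Every point has a neighbourhood of finite volume, because the density is bounded on a
  closed coordinate ball. Compactness leaves finitely many such neighbourhoods.\<close>

lemma finite_measure_riem_volume:
  assumes g: "g \<in> riem_metrics A"
  shows "finite_measure (riem_volume A g)"
proof -
  let ?\<mu> = "riem_volume A g"
  have "\<exists>S. open S \<and> p \<in> S \<and> emeasure ?\<mu> S < \<infinity>" for p
  proof -
    let ?c = "chart_at A p"
    note c = chart_at[of p]
    obtain r where r: "r > 0" "cball (snd ?c p) r \<subseteq> snd ?c ` fst ?c"
      using open_chart(2)[OF c(1)] c(2) open_contains_cball by blast
    let ?K = "cball (snd ?c p) r"
    let ?S = "fst ?c \<inter> snd ?c -` ball (snd ?c p) r"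
    have S: "open ?S"
      using chart_homeo[OF c(1)] open_chart(1)[OF c(1)]
      by (intro continuous_open_preimage) (auto simp: homeomorphism_def)
    have "continuous_on ?K (\<lambda>x. sqrt (det (components g ?c x)))"
      using continuous_on_subset[OF continuous_on_components[OF metric_in_sym[OF g] c(1)] r(2)]
      unfolding continuous_on_def by (intro ballI tendsto_real_sqrt tendsto_det) auto
    then have "bounded ((\<lambda>x. sqrt (det (components g ?c x))) ` ?K)"
      by (intro compact_imp_bounded compact_continuous_image compact_cball)
    then obtain b where b: "\<And>x. x \<in> ?K \<Longrightarrow> sqrt (det (components g ?c x)) \<le> b"
      unfolding bounded_iff by (metis abs_le_D1 image_eqI real_norm_def)
    have "emeasure ?\<mu> ?S = (\<integral>\<^sup>+x\<in>snd ?c ` ?S. ennreal (sqrt (det (components g ?c x))) \<partial>lborel)"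
      using S by (intro emeasure_riem_volume g c) auto
    also have "\<dots> \<le> (\<integral>\<^sup>+x. ennreal b * indicator ?K x \<partial>lborel)"
      using b by (intro nn_integral_mono) (auto simp: indicator_def intro!: ennreal_leI)
    also have "\<dots> = ennreal b * emeasure lborel ?K"
      by (intro nn_integral_cmult_indicator) simp
    also have "\<dots> < \<infinity>"
      using emeasure_bounded_finite[OF bounded_cball[of "snd ?c p" r]] by (simp add: ennreal_mult_less_top)
    finally show ?thesis using S c r(1) by (intro exI[of _ ?S]) auto
  qed
  then obtain S where S: "\<And>p. open (S p)" "\<And>p. p \<in> S p" "\<And>p. emeasure ?\<mu> (S p) < \<infinity>" by metis
  obtain L where L: "finite L" "UNIV \<subseteq> (\<Union>p\<in>L. S p)"
    by (rule compactE_image[OF compact_UNIV, of UNIV S]) (use S in auto)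
  have "space ?\<mu> = (\<Union>p\<in>L. S p)" using L(2) space_riem_volume[OF g] by auto
  moreover have "emeasure ?\<mu> (\<Union>p\<in>L. S p) \<le> (\<Sum>p\<in>L. emeasure ?\<mu> (S p))"
    using L(1) S(1) sets_riem_volume[OF g] by (intro emeasure_subadditive_finite) auto
  ultimately have "emeasure ?\<mu> (space ?\<mu>) \<le> (\<Sum>p\<in>L. emeasure ?\<mu> (S p))" by simp
  also have "\<dots> < \<infinity>" using S(3) L(1) by simp
  finally show ?thesis by (intro finite_measureI) simp
qed

text \<open>If a non-empty chart had volume zero, its positive density would make the open image of
  the chart a null set. Finiteness enters too, since \<open>measure\<close> turns an infinite value
  into 0.\<close>

lemma total_volume_pos:
  assumes g: "g \<in> riem_metrics A"
  shows "total_volume A g > 0"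
proof -
  let ?\<mu> = "riem_volume A g"
  obtain c where c: "c \<in> A" "fst c \<noteq> {}" using chart_at by blast
  have U: "open (snd c ` fst c)" using open_chart c by blast
  have "emeasure ?\<mu> (fst c) \<noteq> 0"
  proof
    assume "emeasure ?\<mu> (fst c) = 0"
    moreover have "(\<integral>\<^sup>+x. ennreal (chart_density g c x) \<partial>lborel) =
        (\<integral>\<^sup>+x\<in>snd c ` fst c. ennreal (sqrt (det (components g c x))) \<partial>lborel)"
      by (intro nn_integral_cong) (simp add: chart_density_def)
    ultimately have "(\<integral>\<^sup>+x. ennreal (chart_density g c x) \<partial>lborel) = 0"
      using emeasure_riem_volume[OF g c(1), of "fst c"] open_chart(1)[OF c(1)] by simp
    then have "AE x in lborel. chart_density g c x \<le> 0"
      using borel_measurable_chart_density[OF g c(1)] by (simp add: nn_integral_0_iff_AE ennreal_eq_0_iff)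
    moreover have "chart_density g c x > 0" if "x \<in> snd c ` fst c" for x
      using that metric_det_pos[OF g c(1)] by (auto simp: chart_density_chart c)
    ultimately have "AE x in lborel. x \<notin> snd c ` fst c" by (elim AE_mp, intro AE_I2 impI) force
    then have "snd c ` fst c \<in> null_sets lborel"
      using U by (subst (asm) AE_iff_measurable[OF _ refl]) auto
    then have "negligible (snd c ` fst c)"
      by (simp add: negligible_iff_null_sets null_sets_completionI)
    then show False using U c(2) open_not_negligible by blast
  qed
  then have "emeasure ?\<mu> UNIV \<noteq> 0"
    using emeasure_mono[of "fst c" UNIV ?\<mu>] sets_riem_volume[OF g] by auto
  then show ?thesis
    unfolding total_volume_def measure_def
    using finite_measure.emeasure_finite[OF finite_measure_riem_volume[OF g], of UNIV]
    by (simp add: enn2real_positive_iff less_top zero_less_iff_neq_zero)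
qed

text \<open>For metrics this is the density of the volume of \<open>g'\<close> with respect to the
  volume of \<open>g\<close>. It moves the dependence on the metric from the measure into the
  integrand.\<close>

definition volume_ratio :: "('m, 'n) tensor \<Rightarrow> ('m, 'n) tensor \<Rightarrow> 'm \<Rightarrow> real" where
  "volume_ratio g g' p = sqrt (det (endo g g' (chart_at A p) p))"

lemma volume_ratio_chart:
  assumes "g \<in> riem_metrics A" "g' \<in> riem_metrics A" "c \<in> A" "p \<in> fst c"
  shows "volume_ratio g g' p = sqrt (det (endo g g' c p))"
  unfolding volume_ratio_def
  using endo_invariants(2)[OF assms(1) metric_in_sym[OF assms(2)] metric_in_sym[OF assms(2)] chart_at(1) assms(3) chart_at(2) assms(4)]
  by simp

text \<open>A function written with \<open>chart_at A p\<close> changes charts in an uncontrolled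
  way as \<open>p\<close> moves. Continuity is therefore checked for the expression
  \<open>F c\<close> in a fixed chart, with which the function agrees on that chart.\<close>

lemma continuous_onI_chart:
  fixes f :: "'m \<Rightarrow> 'b::topological_space"
  assumes "\<And>p c. c \<in> A \<Longrightarrow> p \<in> fst c \<Longrightarrow> (F c \<longlongrightarrow> F c p) (nhds p)"
    and "\<And>p c. c \<in> A \<Longrightarrow> p \<in> fst c \<Longrightarrow> f p = F c p"
  shows "continuous_on UNIV f"
proof (intro continuous_at_imp_continuous_on ballI)
  fix p
  note c = chart_at[of p]
  have "eventually (\<lambda>q. F (chart_at A p) q = f q) (nhds p)"
    using eventually_chart[OF c] by eventually_elim (rule assms(2)[OF c(1), symmetric])
  then have "(f \<longlongrightarrow> f p) (nhds p)"
    using Lim_transform_eventually[OF assms(1)[OF c]] assms(2)[OF c] by metis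
  then show "isCont f p" unfolding isCont_def unfolding at_within_def by (rule tendsto_mono[OF inf_le1])
qed

lemma continuous_volume_ratio:
  assumes "g \<in> riem_metrics A" "g' \<in> riem_metrics A"
  shows "continuous_on UNIV (volume_ratio g g')"
proof (rule continuous_onI_chart)
  fix p c assume "c \<in> A" "p \<in> fst c"
  then show "((\<lambda>p. sqrt (det (endo g g' c p))) \<longlongrightarrow> sqrt (det (endo g g' c p))) (nhds p)"
    by (intro tendsto_real_sqrt tendsto_det tendsto_endo assms metric_in_sym)
qed (use volume_ratio_chart[OF assms] in auto)

text \<open>By uniqueness of the Riemannian volume it is enough to compare values in each chart,
  where the claim is multiplicativity of the determinant.\<close>

lemma riem_volume_density:
  assumes g: "g \<in> riem_metrics A" and g': "g' \<in> riem_metrics A"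
  shows "riem_volume A g' = density (riem_volume A g) (\<lambda>p. ennreal (volume_ratio g g' p))"
proof (rule riem_volume_eqI)
  let ?v = "\<lambda>p. ennreal (volume_ratio g g' p)"
  have v: "?v \<in> borel_measurable borel"
    using borel_measurable_continuous_onI[OF continuous_volume_ratio[OF assms]] by simp
  then have v': "?v \<in> borel_measurable (riem_volume A g)"
    using measurable_cong_sets[OF sets_riem_volume[OF g] refl] by blast
  have "emeasure (density (riem_volume A g) ?v) B = (\<integral>\<^sup>+x\<in>snd c ` B. ennreal (sqrt (det (components g' c x))) \<partial>lborel)"
    if c: "c \<in> A" and B: "B \<in> sets borel" "B \<subseteq> fst c" for c B
  proof -
    have "emeasure (density (riem_volume A g) ?v) B = (\<integral>\<^sup>+p\<in>B. ?v p \<partial>riem_volume A g)"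
      using v' B sets_riem_volume[OF g] by (intro emeasure_density) auto
    also have "\<dots> = (\<integral>\<^sup>+x\<in>snd c ` B. ennreal (sqrt (det (components g c x))) * ?v (chart_inv c x) \<partial>lborel)"
      by (rule nn_integral_riem_volume[OF g c v B])
    also have "\<dots> = (\<integral>\<^sup>+x\<in>snd c ` B. ennreal (sqrt (det (components g' c x))) \<partial>lborel)"
    proof (intro nn_integral_cong)
      fix x
      show "ennreal (sqrt (det (components g c x))) * ?v (chart_inv c x) * indicator (snd c ` B) x =
        ennreal (sqrt (det (components g' c x))) * indicator (snd c ` B) x"
      proof (cases "x \<in> snd c ` B")
        case True
        then obtain p where p: "p \<in> fst c" "x = snd c p" using B by auto
        have det: "det (g c p) > 0" by (rule metric_det_pos[OF g c p(1)])
        have "det (g c p) * det (endo g g' c p) = det ((g c p ** matrix_inv (g c p)) ** g' c p)"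
          by (simp add: endo_def det_mul)
        also have "\<dots> = det (g' c p)" using det by (simp add: matrix_inv_right)
        finally have "sqrt (det (g c p)) * volume_ratio g g' p = sqrt (det (g' c p))"
          by (simp add: volume_ratio_chart[OF g g' c p(1)] real_sqrt_mult[symmetric])
        then show ?thesis
          using p c det by (simp add: components_chart ennreal_mult'[symmetric])
      qed simp
    qed
    finally show ?thesis .
  qed
  then show "is_riem_volume A g' (density (riem_volume A g) ?v)"
    unfolding is_riem_volume_def using sets_riem_volume[OF g] by simp
qed

lemma integrable_continuous:
  fixes f :: "'m \<Rightarrow> real"
  assumes g: "g \<in> riem_metrics A" and f: "continuous_on UNIV f"
  shows "integrable (riem_volume A g) f"
proof -
  interpret finite_measure "riem_volume A g" by (rule finite_measure_riem_volume[OF g])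
  have "bounded (range f)"
    by (intro compact_imp_bounded compact_continuous_image f compact_UNIV)
  then obtain B where "\<And>p. norm (f p) \<le> B" by (auto simp: bounded_iff)
  moreover have "f \<in> borel_measurable (riem_volume A g)"
    using borel_measurable_continuous_onI[OF f] measurable_cong_sets[OF sets_riem_volume[OF g] refl] by blast
  ultimately show ?thesis by (intro integrable_const_bound[where B = B]) auto
qed

lemma integral_change_metric:
  fixes f :: "'m \<Rightarrow> real"
  assumes g: "g \<in> riem_metrics A" and g': "g' \<in> riem_metrics A" and f: "continuous_on UNIV f"
  shows "(\<integral>p. f p \<partial>riem_volume A g') = (\<integral>p. f p * volume_ratio g g' p \<partial>riem_volume A g)"
proof -
  have "\<forall>h. continuous_on UNIV h \<longrightarrow> h \<in> borel_measurable (riem_volume A g)" for h :: "'m \<Rightarrow> real"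
    using borel_measurable_continuous_onI measurable_cong_sets[OF sets_riem_volume[OF g] refl] by blast
  moreover have "volume_ratio g g' p \<ge> 0" for p
  proof -
    note c = chart_at[of p]
    have "det (endo g g' (chart_at A p) p) * det (g (chart_at A p) p) =
        det ((g (chart_at A p) p ** matrix_inv (g (chart_at A p) p)) ** g' (chart_at A p) p)"
      by (simp add: endo_def det_mul)
    also have "\<dots> > 0"
      using metric_det_pos[OF g c] metric_det_pos[OF g' c] by (simp add: matrix_inv_right)
    finally show ?thesis
      using metric_det_pos[OF g c] by (simp add: volume_ratio_def zero_less_mult_iff)
  qed
  ultimately show ?thesis
    unfolding riem_volume_density[OF g g']
    using continuous_volume_ratio[OF g g'] f by (subst integral_density) (auto simp: mult.commute)
qed

end

section \<open>Differentiating the integral of a trace\<close>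

text \<open>
  The base point varies along with the parameter: joint convergence is what compactness upgrades to
  uniform convergence on the manifold.
\<close>

lemma tendsto_trace_quotient:
  fixes a a' :: "'b \<Rightarrow> real^'n::finite^'n" and k k' :: "'b \<Rightarrow> real^'n^'n"
  assumes e: "(e \<longlongrightarrow> 0) F" and nz: "eventually (\<lambda>x. e x \<noteq> 0) F"
    and a: "(a \<longlongrightarrow> a0) F" and k: "(k \<longlongrightarrow> k0) F"
    and h: "((\<lambda>x. (1 / e x) *\<^sub>R (a' x - a x)) \<longlongrightarrow> h0) F"
    and l: "((\<lambda>x. (1 / e x) *\<^sub>R (k' x - k x)) \<longlongrightarrow> l0) F"
    and det: "det a0 > 0"
  shows "((\<lambda>x. (trace (matrix_inv (a' x) ** k' x) * sqrt (det (matrix_inv (a x) ** a' x))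
        - trace (matrix_inv (a x) ** k x)) / e x)
    \<longlongrightarrow> trace (matrix_inv a0 ** l0) - trace ((matrix_inv a0 ** h0) ** (matrix_inv a0 ** k0))
      + trace (matrix_inv a0 ** h0) / 2 * trace (matrix_inv a0 ** k0)) F"
proof -
  let ?H = "\<lambda>x. (1 / e x) *\<^sub>R (a' x - a x)" and ?L = "\<lambda>x. (1 / e x) *\<^sub>R (k' x - k x)"
  let ?D = "\<lambda>x. det (matrix_inv (a x) ** a' x)"
  let ?T = "\<lambda>x. trace (matrix_inv (a x) ** k x)"
  have ev_eq: "eventually (\<lambda>x. a x + e x *\<^sub>R ?H x = a' x) F"
    using nz by eventually_elim simp
  have "((\<lambda>x. a x + e x *\<^sub>R ?H x) \<longlongrightarrow> a0 + 0 *\<^sub>R h0) F"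
    by (intro tendsto_add tendsto_scaleR a h e)
  then have a': "(a' \<longlongrightarrow> a0) F"
    using Lim_transform_eventually[OF _ ev_eq] by simp
  have ev_det: "eventually (\<lambda>x. det (a x) > 0) F" "eventually (\<lambda>x. det (a' x) > 0) F"
    using order_tendstoD(1)[OF tendsto_det[OF a] det] order_tendstoD(1)[OF tendsto_det[OF a'] det] by auto
  note inv = tendsto_matrix_inv[OF a] tendsto_matrix_inv[OF a']
  have det0: "det a0 \<noteq> 0" using det by simp
  \<comment> \<open>The determinant ratio is expanded around the identity after factoring out
    \<open>a x\<close>.\<close>
  have "((\<lambda>x. (det (mat 1 + e x *\<^sub>R (matrix_inv (a x) ** ?H x)) - 1) / e x) \<longlongrightarrow> trace (matrix_inv a0 ** h0)) F"
    by (intro det_mat_1_quotient tendsto_matrix_matrix_mult inv det0 h e nz)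
  moreover have "eventually (\<lambda>x. (det (mat 1 + e x *\<^sub>R (matrix_inv (a x) ** ?H x)) - 1) / e x = (?D x - 1) / e x) F"
    using nz ev_det
  proof eventually_elim
    case (elim x)
    have "matrix_inv (a x) ** a' x = matrix_inv (a x) ** (1 *\<^sub>R a x + e x *\<^sub>R ?H x)"
      using elim by simp
    also have "\<dots> = mat 1 + e x *\<^sub>R (matrix_inv (a x) ** ?H x)"
      using elim unfolding matrix_mult_lincomb_right by (simp add: matrix_inv_left)
    finally show ?case by simp
  qed
  ultimately have D: "((\<lambda>x. (?D x - 1) / e x) \<longlongrightarrow> trace (matrix_inv a0 ** h0)) F"
    by (rule Lim_transform_eventually)
  have "(?D \<longlongrightarrow> det (matrix_inv a0 ** a0)) F"
    by (intro tendsto_det tendsto_matrix_matrix_mult inv det0 a')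
  then have D1: "(?D \<longlongrightarrow> 1) F" by (simp add: matrix_inv_left det0)
  then have R1: "((\<lambda>x. sqrt (?D x)) \<longlongrightarrow> 1) F" using tendsto_real_sqrt by fastforce
  \<comment> \<open>Dividing by \<open>sqrt (?D x) + 1\<close>, which tends to 2, passes from the
    quotient of \<open>?D\<close> to that of its root. This is the origin of the factor 1/2.\<close>
  have "((\<lambda>x. (?D x - 1) / e x / (sqrt (?D x) + 1)) \<longlongrightarrow> trace (matrix_inv a0 ** h0) / (1 + 1)) F"
    by (intro tendsto_divide D tendsto_add R1 tendsto_const) simp
  moreover have "eventually (\<lambda>x. (?D x - 1) / e x / (sqrt (?D x) + 1) = (sqrt (?D x) - 1) / e x) F"
    using order_tendstoD(1)[OF D1, of 0, simplified]
  proof eventually_elim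
    case (elim x)
    then have *: "sqrt (?D x) + 1 > 0" "?D x - 1 = (sqrt (?D x) - 1) * (sqrt (?D x) + 1)"
      by (auto intro: add_nonneg_pos simp: algebra_simps)
    show ?case using *(1) unfolding *(2) by simp
  qed
  ultimately have R: "((\<lambda>x. (sqrt (?D x) - 1) / e x) \<longlongrightarrow> trace (matrix_inv a0 ** h0) / 2) F"
    using Lim_transform_eventually by fastforce
  \<comment> \<open>The difference telescopes: first \<open>k'\<close> becomes \<open>k\<close>,
    then \<open>a'\<close> becomes \<open>a\<close> by the resolvent identity a'^-1 - a^-1 = - a'^-1
    (a' - a) a^-1, and finally the root becomes 1.\<close>
  have "((\<lambda>x. (trace (matrix_inv (a' x) ** ?L x)
      - trace ((matrix_inv (a' x) ** ?H x) ** (matrix_inv (a x) ** k x))) * sqrt (?D x)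
      + (sqrt (?D x) - 1) / e x * ?T x)
    \<longlongrightarrow> (trace (matrix_inv a0 ** l0) - trace ((matrix_inv a0 ** h0) ** (matrix_inv a0 ** k0))) * 1
      + trace (matrix_inv a0 ** h0) / 2 * trace (matrix_inv a0 ** k0)) F"
    by (intro tendsto_add tendsto_mult tendsto_diff tendsto_trace tendsto_matrix_matrix_mult inv det0 h l k R R1)
  moreover have "eventually (\<lambda>x. (trace (matrix_inv (a' x) ** ?L x)
      - trace ((matrix_inv (a' x) ** ?H x) ** (matrix_inv (a x) ** k x))) * sqrt (?D x)
      + (sqrt (?D x) - 1) / e x * ?T x =
      (trace (matrix_inv (a' x) ** k' x) * sqrt (?D x) - ?T x) / e x) F"
    using nz ev_det
  proof eventually_elim
    case (elim x)
    let ?b = "matrix_inv (a x)" and ?b' = "matrix_inv (a' x)"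
    have "?b' ** ?L x = (1 / e x) *\<^sub>R (?b' ** k' x) + (- 1 / e x) *\<^sub>R (?b' ** k x)"
      unfolding matrix_mult_lincomb_right[symmetric] by (simp add: scaleR_diff_right)
    moreover have "(?b' ** ?H x) ** (?b ** k x) = (1 / e x) *\<^sub>R (?b ** k x) + (- 1 / e x) *\<^sub>R (?b' ** k x)"
    proof -
      have "?b' ** ?H x = (1 / e x) *\<^sub>R (?b' ** a' x) + (- 1 / e x) *\<^sub>R (?b' ** a x)"
        unfolding matrix_mult_lincomb_right[symmetric] by (simp add: scaleR_diff_right)
      then have "(?b' ** ?H x) ** (?b ** k x) =
          (1 / e x) *\<^sub>R ((?b' ** a' x) ** (?b ** k x)) + (- 1 / e x) *\<^sub>R ((?b' ** a x) ** (?b ** k x))"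
        by (simp only: matrix_mult_lincomb_left)
      also have "(?b' ** a x) ** (?b ** k x) = ?b' ** (a x ** ?b) ** k x"
        by (simp only: matrix_mul_assoc)
      finally show ?thesis using elim by (simp add: matrix_inv_left matrix_inv_right)
    qed
    moreover have tr: "trace (u *\<^sub>R X + v *\<^sub>R Y) = u * trace X + v * trace Y" for u v and X Y :: "real^'n^'n"
      by (simp add: trace_def sum.distrib sum_distrib_left)
    ultimately show ?case using elim(1) by (simp only: tr) (simp add: field_simps)
  qed
  ultimately show ?thesis unfolding mult_1_right by (rule Lim_transform_eventually)
qed

section \<open>Joint limits, and differentiation under the integral sign\<close>

context closed_mfd
begin

text \<open>Uniform convergence of the components on a closed coordinate ball, which is the case of
  the empty list of derivatives, is combined with continuity of the limit \<open>h\<close>.\<close>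

lemma tendsto_tensor_joint:
  assumes H: "tensor_tendsto A H h F" and h: "h \<in> sym_tensor_fields A" and c: "c \<in> A" "p \<in> fst c"
  shows "((\<lambda>(u, q). H u c q) \<longlongrightarrow> h c p) (F \<times>\<^sub>F nhds p)"
proof (rule tendstoI)
  fix e :: real assume e: "e > 0"
  obtain r where r: "r > 0" "cball (snd c p) r \<subseteq> snd c ` fst c"
    using open_chart(2)[OF c(1)] c(2) open_contains_cball by blast
  have "uniform_limit (cball (snd c p) r) (\<lambda>t. iter_deriv [] (components (H t) c)) (iter_deriv [] (components h c)) F"
    using H r(2) c(1) compact_cball unfolding tensor_tendsto_def by blast
  then have u: "eventually (\<lambda>u. \<forall>x\<in>cball (snd c p) r. dist (components (H u) c x) (components h c x) < e / 2) F"
    using uniform_limitD[of _ _ _ _ "e / 2"] e by fastforce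
  have "eventually (\<lambda>q. dist (h c q) (h c p) < e / 2) (nhds p)"
    using tendstoD[OF tendsto_tensor[OF h c], of "e / 2"] e by simp
  moreover have "eventually (\<lambda>q. dist (snd c q) (snd c p) < r) (nhds p)"
    using tendstoD[OF tendsto_chart[OF c] r(1)] .
  moreover note eventually_chart[OF c]
  ultimately have "eventually (\<lambda>q. dist (h c q) (h c p) < e / 2 \<and> dist (snd c q) (snd c p) < r \<and> q \<in> fst c) (nhds p)"
    by eventually_elim simp
  with u have "eventually (\<lambda>(u, q). (\<forall>x\<in>cball (snd c p) r. dist (components (H u) c x) (components h c x) < e / 2)
      \<and> dist (h c q) (h c p) < e / 2 \<and> dist (snd c q) (snd c p) < r \<and> q \<in> fst c) (F \<times>\<^sub>F nhds p)"
    unfolding eventually_prod_filter by (intro exI conjI) auto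
  then show "eventually (\<lambda>x. dist ((\<lambda>(u, q). H u c q) x) (h c p) < e) (F \<times>\<^sub>F nhds p)"
  proof (rule eventually_mono, clarify)
    fix u q
    assume 1: "\<forall>x\<in>cball (snd c p) r. dist (components (H u) c x) (components h c x) < e / 2"
      and 2: "dist (h c q) (h c p) < e / 2" "dist (snd c q) (snd c p) < r" and q: "q \<in> fst c"
    have "snd c q \<in> cball (snd c p) r" using 2(2) by (simp add: dist_commute)
    with 1 have "dist (H u c q) (h c q) < e / 2" using components_chart[OF c(1) q] by fastforce
    with 2(1) show "dist (H u c q) (h c p) < e"
      using dist_triangle[of "H u c q" "h c p" "h c q"] by simp
  qed
qed

lemma continuous_trace_endo:
  assumes g: "g \<in> riem_metrics A" and h: "h \<in> sym_tensor_fields A"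
  shows "continuous_on UNIV (\<lambda>p. trace (endo g h (chart_at A p) p))"
proof (rule continuous_onI_chart)
  fix p c assume c: "c \<in> A" "p \<in> fst c"
  show "((\<lambda>p. trace (endo g h c p)) \<longlongrightarrow> trace (endo g h c p)) (nhds p)"
    by (intro tendsto_trace tendsto_endo g h c)
  show "trace (endo g h (chart_at A p) p) = trace (endo g h c p)"
    by (rule endo_invariants(1)[OF g h h chart_at(1) c(1) chart_at(2) c(2)])
qed

lemma continuous_trace_endo2:
  assumes g: "g \<in> riem_metrics A" and h: "h \<in> sym_tensor_fields A" and k: "k \<in> sym_tensor_fields A"
  shows "continuous_on UNIV (\<lambda>p. trace (endo g h (chart_at A p) p ** endo g k (chart_at A p) p))"
proof (rule continuous_onI_chart)
  fix p c assume c: "c \<in> A" "p \<in> fst c"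
  show "((\<lambda>p. trace (endo g h c p ** endo g k c p)) \<longlongrightarrow> trace (endo g h c p ** endo g k c p)) (nhds p)"
    by (intro tendsto_trace tendsto_matrix_matrix_mult tendsto_endo g h k c)
  show "trace (endo g h (chart_at A p) p ** endo g k (chart_at A p) p) = trace (endo g h c p ** endo g k c p)"
    by (rule endo_invariants(3)[OF g h k chart_at(1) c(1) chart_at(2) c(2)])
qed

abbreviation tr :: "('m, 'n) tensor \<Rightarrow> ('m, 'n) tensor \<Rightarrow> 'm \<Rightarrow> real" where
  "tr g h p \<equiv> trace (endo g h (chart_at A p) p)"

abbreviation tr2 :: "('m, 'n) tensor \<Rightarrow> ('m, 'n) tensor \<Rightarrow> ('m, 'n) tensor \<Rightarrow> 'm \<Rightarrow> real" where
  "tr2 g h k p \<equiv> trace (endo g h (chart_at A p) p ** endo g k (chart_at A p) p)"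

text \<open>At a metric this is both g_E(g, k) and twice the differential of the volume in the
  direction \<open>k\<close>. The gradient property of the radial field rests on this
  coincidence.\<close>

definition integral_tr :: "('m, 'n) tensor \<Rightarrow> ('m, 'n) tensor \<Rightarrow> real" where
  "integral_tr g k = (\<integral>p. tr g k p \<partial>riem_volume A g)"

text \<open>The three terms come from the variation \<open>l\<close> of \<open>k\<close>, from the
  variation \<open>h\<close> of \<open>g\<close> inside the inverse, and from the same variation
  inside the volume density.\<close>

definition integral_tr_deriv ::
  "('m, 'n) tensor \<Rightarrow> ('m, 'n) tensor \<Rightarrow> ('m, 'n) tensor \<Rightarrow> ('m, 'n) tensor \<Rightarrow> real" where
  "integral_tr_deriv g k h l =
    (\<integral>p. tr g l p - tr2 g h k p + tr g h p / 2 * tr g k p \<partial>riem_volume A g)"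

text \<open>All integrals are moved to the finite measure of \<open>\<gamma> t\<close>; there the
  integrands of the difference quotients converge uniformly, so the limit passes through the
  integral. Derivatives are taken within \<open>J\<close> because geodesics may contain end points
  of their interval.\<close>

lemma has_deriv_integral_tr:
  assumes \<gamma>: "\<And>u. u \<in> J \<Longrightarrow> \<gamma> u \<in> riem_metrics A" and \<kappa>: "\<And>u. u \<in> J \<Longrightarrow> \<kappa> u \<in> sym_tensor_fields A"
    and t: "t \<in> J" and h: "h \<in> sym_tensor_fields A" and l: "l \<in> sym_tensor_fields A"
    and \<gamma>': "has_tensor_deriv A J \<gamma> h t" and \<kappa>': "has_tensor_deriv A J \<kappa> l t"
  shows "((\<lambda>u. integral_tr (\<gamma> u) (\<kappa> u)) has_real_derivative integral_tr_deriv (\<gamma> t) (\<kappa> t) h l) (at t within J)"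
proof -
  let ?g = "\<gamma> t" and ?k = "\<kappa> t" and ?F = "at t within J"
  let ?\<mu> = "riem_volume A ?g"
  define q where "q u p = (tr (\<gamma> u) (\<kappa> u) p * volume_ratio ?g (\<gamma> u) p - tr ?g ?k p) / (u - t)" for u p
  define D where "D p = tr ?g l p - tr2 ?g h ?k p + tr ?g h p / 2 * tr ?g ?k p" for p
  have g: "?g \<in> riem_metrics A" and k: "?k \<in> sym_tensor_fields A" using t \<gamma> \<kappa> by auto
  have D_cont: "continuous_on UNIV D"
    unfolding D_def by (intro continuous_intros continuous_trace_endo continuous_trace_endo2 g h k l) simp
  have J: "eventually (\<lambda>u. u \<in> J \<and> u \<noteq> t) ?F"
    by (simp add: eventually_at_filter)
  have lim: "((\<lambda>(u, p). q u p) \<longlongrightarrow> D p) (?F \<times>\<^sub>F nhds p)" for p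
  proof -
    let ?c = "chart_at A p" and ?G = "?F \<times>\<^sub>F nhds p"
    note c = chart_at[of p]
    have ev: "eventually (\<lambda>x. fst x \<in> J \<and> fst x \<noteq> t) ?G"
      by (rule eventually_compose_filterlim[OF J filterlim_fst])
    have evc: "eventually (\<lambda>x. snd x \<in> fst ?c) ?G"
      by (rule eventually_compose_filterlim[OF eventually_chart[OF c] filterlim_snd])
    have dq: "((\<lambda>x. (1 / (fst x - t)) *\<^sub>R (\<eta> (fst x) ?c (snd x) - \<eta> t ?c (snd x))) \<longlongrightarrow> m ?c p) ?G"
      if "has_tensor_deriv A J \<eta> m t" "m \<in> sym_tensor_fields A" for \<eta> m
      using tendsto_tensor_joint[OF that(1)[unfolded has_tensor_deriv_def] that(2) c]
      by (simp add: case_prod_unfold tscale_def)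
    have "((\<lambda>x. (trace (matrix_inv (\<gamma> (fst x) ?c (snd x)) ** \<kappa> (fst x) ?c (snd x))
          * sqrt (det (matrix_inv (?g ?c (snd x)) ** \<gamma> (fst x) ?c (snd x)))
          - trace (matrix_inv (?g ?c (snd x)) ** ?k ?c (snd x))) / (fst x - t)) \<longlongrightarrow>
        trace (matrix_inv (?g ?c p) ** l ?c p) - trace ((matrix_inv (?g ?c p) ** h ?c p) ** (matrix_inv (?g ?c p) ** ?k ?c p))
      + trace (matrix_inv (?g ?c p) ** h ?c p) / 2 * trace (matrix_inv (?g ?c p) ** ?k ?c p)) ?G"
    proof (rule tendsto_trace_quotient)
      have "filterlim fst (nhds t) ?G"
        by (rule filterlim_mono[OF filterlim_fst _ order_refl]) (simp add: at_within_def)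
      then show "((\<lambda>x. fst x - t) \<longlongrightarrow> 0) ?G" using tendsto_diff[OF _ tendsto_const, of fst t ?G t] by simp
      show "eventually (\<lambda>x. fst x - t \<noteq> 0) ?G" using ev by eventually_elim simp
      show "((\<lambda>x. ?g ?c (snd x)) \<longlongrightarrow> ?g ?c p) ?G" "((\<lambda>x. ?k ?c (snd x)) \<longlongrightarrow> ?k ?c p) ?G"
        by (rule filterlim_compose[OF tendsto_tensor filterlim_snd]; fact metric_in_sym[OF g] k c)+
      show "det (?g ?c p) > 0" by (rule metric_det_pos[OF g c])
    qed (use dq \<gamma>' \<kappa>' h l in auto)
    moreover have "eventually (\<lambda>x. (trace (matrix_inv (\<gamma> (fst x) ?c (snd x)) ** \<kappa> (fst x) ?c (snd x))
          * sqrt (det (matrix_inv (?g ?c (snd x)) ** \<gamma> (fst x) ?c (snd x)))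
          - trace (matrix_inv (?g ?c (snd x)) ** ?k ?c (snd x))) / (fst x - t) = q (fst x) (snd x)) ?G"
      using ev evc
    proof eventually_elim
      case (elim x)
      have m: "\<gamma> (fst x) \<in> riem_metrics A" "\<kappa> (fst x) \<in> sym_tensor_fields A" using elim \<gamma> \<kappa> by auto
      have "tr m n (snd x) = trace (endo m n ?c (snd x))"
        if "m \<in> riem_metrics A" "n \<in> sym_tensor_fields A" for m n
        using elim(2) by (rule endo_invariants(1)[OF that(1) that(2) that(2) chart_at(1) c(1) chart_at(2)])
      then show ?case
        using m g k volume_ratio_chart[OF g m(1) c(1) elim(2)] by (simp add: q_def endo_def)
    qed
    ultimately show ?thesis
      unfolding case_prod_unfold D_def endo_def by (rule Lim_transform_eventually)
  qed
  \<comment> \<open>The joint limit at each point and continuity of \<open>D\<close> make the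
    difference small near each point; the tube lemma makes this uniform.\<close>
  have unif: "eventually (\<lambda>u. \<forall>p. \<bar>q u p - D p\<bar> < e) ?F" if e: "e > 0" for e
  proof -
    have "eventually (\<lambda>u. \<forall>p\<in>UNIV. (\<lambda>(u, p). \<bar>q u p - D p\<bar> < e) (u, p)) ?F"
    proof (rule eventually_ball_compact[OF compact_UNIV])
      fix p :: 'm
      have "(D \<longlongrightarrow> D p) (nhds p)"
        using D_cont by (simp add: continuous_on_eq_continuous_at isCont_def tendsto_nhds_iff)
      then have "((\<lambda>x. (\<lambda>(u, p). q u p) x - D (snd x)) \<longlongrightarrow> D p - D p) (?F \<times>\<^sub>F nhds p)"
        by (intro tendsto_diff lim filterlim_compose[OF _ filterlim_snd])
      then have "eventually (\<lambda>x. dist ((\<lambda>(u, p). q u p) x - D (snd x)) (D p - D p) < e) (?F \<times>\<^sub>F nhds p)"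
        using e by (rule tendstoD)
      then show "eventually (\<lambda>(u, p). \<bar>q u p - D p\<bar> < e) (?F \<times>\<^sub>F nhds p)"
        by (simp add: case_prod_unfold dist_real_def)
    qed
    then show ?thesis by simp
  qed
  interpret finite_measure ?\<mu> by (rule finite_measure_riem_volume[OF g])
  let ?V = "measure ?\<mu> UNIV"
  have D_int: "integrable ?\<mu> D" by (rule integrable_continuous[OF g D_cont])
  have q_int: "integrable ?\<mu> (q u)" and q_eq: "(\<integral>p. q u p \<partial>?\<mu>) = (integral_tr (\<gamma> u) (\<kappa> u) - integral_tr ?g ?k) / (u - t)"
    if "u \<in> J" for u
  proof -
    have m: "\<gamma> u \<in> riem_metrics A" "\<kappa> u \<in> sym_tensor_fields A" using that \<gamma> \<kappa> by auto
    have 1: "integrable ?\<mu> (\<lambda>p. tr (\<gamma> u) (\<kappa> u) p * volume_ratio ?g (\<gamma> u) p)"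
      by (intro integrable_continuous g continuous_on_mult continuous_trace_endo continuous_volume_ratio m)
    have 2: "integrable ?\<mu> (tr ?g ?k)"
      by (intro integrable_continuous g continuous_trace_endo k)
    show "integrable ?\<mu> (q u)" unfolding q_def using 1 2 by simp
    show "(\<integral>p. q u p \<partial>?\<mu>) = (integral_tr (\<gamma> u) (\<kappa> u) - integral_tr ?g ?k) / (u - t)"
      unfolding q_def integral_tr_def using 1 2
      by (simp add: integral_change_metric[OF g m(1) continuous_trace_endo[OF m]])
  qed
  have "((\<lambda>u. (integral_tr (\<gamma> u) (\<kappa> u) - integral_tr ?g ?k) / (u - t)) \<longlongrightarrow> (\<integral>p. D p \<partial>?\<mu>)) ?F"
  proof (rule tendstoI)
    fix e :: real assume e: "e > 0"
    \<comment> \<open>Chosen so that the total mass times \<open>e'\<close> stays strictly below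
      \<open>e\<close>.\<close>
    define e' where "e' = e / (?V + 1)"
    have V1: "?V + 1 > 0" by (simp add: add_nonneg_pos)
    have e': "e' > 0" using e V1 by (simp add: e'_def)
    from unif[OF e'] J
    show "eventually (\<lambda>u. dist ((integral_tr (\<gamma> u) (\<kappa> u) - integral_tr ?g ?k) / (u - t)) (\<integral>p. D p \<partial>?\<mu>) < e) ?F"
    proof eventually_elim
      case (elim u)
      then have u: "u \<in> J" by simp
      have "\<bar>(\<integral>p. q u p \<partial>?\<mu>) - (\<integral>p. D p \<partial>?\<mu>)\<bar> = \<bar>\<integral>p. q u p - D p \<partial>?\<mu>\<bar>"
        using q_int[OF u] D_int by simp
      also have "\<dots> \<le> (\<integral>p. \<bar>q u p - D p\<bar> \<partial>?\<mu>)"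
        by (rule integral_abs_bound)
      also have "\<dots> \<le> (\<integral>p. e' \<partial>?\<mu>)"
        using q_int[OF u] D_int elim by (intro integral_mono) (auto intro: less_imp_le)
      also have "\<dots> = ?V * e'" by (simp add: space_riem_volume[OF g])
      also have "\<dots> < (?V + 1) * e'" using e' by simp
      also have "\<dots> = e" using V1 by (simp add: e'_def)
      finally show ?case by (simp add: q_eq[OF u] dist_real_def)
    qed
  qed
  then show ?thesis
    unfolding has_field_derivative_iff integral_tr_deriv_def D_def .
qed

end

section \<open>The Hessian of the logarithm of the volume\<close>

lemma tensor_tendsto_cong:
  assumes "eventually (\<lambda>u. H u = H' u) F"
  shows "tensor_tendsto A H h F \<longleftrightarrow> tensor_tendsto A H' h F"
proof -
  have "uniform_limit K (\<lambda>t. iter_deriv vs (components (H t) c)) f F \<longleftrightarrow>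
      uniform_limit K (\<lambda>t. iter_deriv vs (components (H' t) c)) f F" for K vs c f
    by (rule uniform_limit_cong) (use assms in \<open>auto elim: eventually_mono\<close>)
  then show ?thesis by (simp add: tensor_tendsto_def)
qed

lemma tensor_tendsto_const: "tensor_tendsto A (\<lambda>_. h) h F"
  by (simp add: tensor_tendsto_def uniform_limit_const)

lemma has_tensor_deriv_affine: "has_tensor_deriv A J (\<lambda>s. g + s *\<^sub>T h) h t"
proof -
  have "eventually (\<lambda>u. (1 / (u - t)) *\<^sub>T ((g + u *\<^sub>T h) - (g + t *\<^sub>T h)) = h) (at t within J)"
    unfolding eventually_at_filter
    by (auto simp: tscale_def fun_eq_iff scaleR_diff_left[symmetric])
  then show ?thesis
    unfolding has_tensor_deriv_def by (simp add: tensor_tendsto_cong tensor_tendsto_const)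
qed

lemma has_tensor_deriv_const: "has_tensor_deriv A J (\<lambda>_. h) 0 t"
proof -
  have "(1 / (u - t)) *\<^sub>T (h - h) = 0" for u by (simp add: tscale_def fun_eq_iff)
  then show ?thesis by (simp add: has_tensor_deriv_def tensor_tendsto_const)
qed

lemma smooth_vector_field_id: "smooth_vector_field A (\<lambda>g. g)"
  by (simp add: smooth_vector_field_def comp_def)

context closed_mfd
begin

text \<open>Convergence on the one-point compact set containing \<open>snd c p\<close> determines
  every component as a pointwise limit, unique because the filter is nontrivial.\<close>

lemma tensor_deriv_eqI:
  assumes h: "h \<in> sym_tensor_fields A" "has_tensor_deriv A J \<gamma> h t" and nt: "at t within J \<noteq> bot"
  shows "tensor_deriv A J \<gamma> t = h"
  unfolding tensor_deriv_def
proof (rule the_equality)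
  fix h' assume h': "h' \<in> sym_tensor_fields A \<and> has_tensor_deriv A J \<gamma> h' t"
  have lim: "((\<lambda>u. ((1 / (u - t)) *\<^sub>T (\<gamma> u - \<gamma> t)) c p) \<longlongrightarrow> k c p) (at t within J)"
    if "has_tensor_deriv A J \<gamma> k t" "c \<in> A" "p \<in> fst c" for k c p
  proof -
    have "uniform_limit {snd c p} (\<lambda>u. iter_deriv [] (components ((1 / (u - t)) *\<^sub>T (\<gamma> u - \<gamma> t)) c))
        (iter_deriv [] (components k c)) (at t within J)"
      by (rule that(1)[unfolded has_tensor_deriv_def tensor_tendsto_def, rule_format, OF that(2)])
        (use that(3) in simp)
    from tendsto_uniform_limitI[OF this, of "snd c p"]
    show ?thesis by (simp only: iter_deriv.simps components_chart[OF that(2,3)] singletonI)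
  qed
  show "h' = h"
  proof (rule tensor_eqI)
    fix c p assume "c \<in> A" "p \<in> fst c"
    then show "h' c p = h c p"
      using tendsto_unique[OF nt lim[of h'] lim[of h]] h' h(2) by simp
  qed (use h h' in simp_all)
qed (use h in auto)

lemma smooth_vector_field_const:
  assumes h: "h \<in> sym_tensor_fields A"
  shows "smooth_vector_field A (\<lambda>_. h)"
proof -
  have "smooth_curve A UNIV (\<lambda>_. h)"
    unfolding smooth_curve_def
    by (rule exI[of _ "\<lambda>k _. if k = (0::nat) then h else 0"])
      (simp add: h zero_in_sym[OF h] has_tensor_deriv_const)
  then show ?thesis by (simp add: smooth_vector_field_def comp_def)
qed

lemma field_dir_deriv_const:
  assumes "h \<in> sym_tensor_fields A"
  shows "field_dir_deriv A (\<lambda>_. h) g k = 0"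
  unfolding field_dir_deriv_def
  by (rule tensor_deriv_eqI) (simp_all add: zero_in_sym[OF assms] has_tensor_deriv_const)

lemma field_dir_deriv_id:
  assumes "h \<in> sym_tensor_fields A"
  shows "field_dir_deriv A (\<lambda>g. g) g h = h"
  unfolding field_dir_deriv_def
  by (rule tensor_deriv_eqI) (simp_all add: assms has_tensor_deriv_affine)

section \<open>Traces, the generalized Calabi metric and its scaling\<close>

lemma tr_self:
  assumes "g \<in> riem_metrics A"
  shows "tr g g p = CARD('n)"
  using endo_self[OF assms chart_at, of p] by (simp add: trace_I)

lemma tr_lincomb: "tr g (a *\<^sub>T h + b *\<^sub>T k) p = a * tr g h p + b * tr g k p"
  by (simp add: endo_lincomb trace_def sum.distrib sum_distrib_left)

lemma tr2_lincomb: "tr2 g (a *\<^sub>T h + b *\<^sub>T k) l p = a * tr2 g h l p + b * tr2 g k l p"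
  by (simp add: endo_lincomb matrix_mult_lincomb_left trace_def sum.distrib sum_distrib_left)

lemma tr2_sym: "tr2 g h k p = tr2 g k h p"
  by (rule trace_mul_sym)

lemma integral_tr_self:
  assumes "g \<in> riem_metrics A"
  shows "integral_tr g g = CARD('n) * total_volume A g"
  by (simp add: integral_tr_def tr_self[OF assms] total_volume_def space_riem_volume[OF assms])

lemma integral_tr_lincomb:
  assumes g: "g \<in> riem_metrics A" and h: "h \<in> sym_tensor_fields A" and k: "k \<in> sym_tensor_fields A"
  shows "integral_tr g (a *\<^sub>T h + b *\<^sub>T k) = a * integral_tr g h + b * integral_tr g k"
  using integrable_continuous[OF g continuous_trace_endo[OF g h]]
    integrable_continuous[OF g continuous_trace_endo[OF g k]]
  unfolding integral_tr_def tr_lincomb by simp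

lemma trace_pairing_eq: "trace_pairing A g h k = tr2 g h k"
  by (simp add: trace_pairing_def endo_def Let_def matrix_mul_assoc fun_eq_iff)

lemma calabi_metric_eq: "calabi_metric A g h k = (\<integral>p. tr2 g h k p \<partial>riem_volume A g) / total_volume A g"
  by (simp add: calabi_metric_def ebin_metric_def trace_pairing_eq)

lemma calabi_metric_sym: "calabi_metric A g h k = calabi_metric A g k h"
  unfolding calabi_metric_eq by (subst tr2_sym) simp

lemma calabi_metric_add:
  assumes g: "g \<in> riem_metrics A" and h: "h \<in> sym_tensor_fields A"
    and k: "k \<in> sym_tensor_fields A" and l: "l \<in> sym_tensor_fields A"
  shows "calabi_metric A g (h + k) l = calabi_metric A g h l + calabi_metric A g k l"
proof -
  have "h + k = 1 *\<^sub>T h + 1 *\<^sub>T k" by (simp add: tscale_def)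
  then have "tr2 g (h + k) l p = tr2 g h l p + tr2 g k l p" for p
    using tr2_lincomb[of g 1 h 1 k] by simp
  then show ?thesis
    using integrable_continuous[OF g continuous_trace_endo2[OF g h l]]
      integrable_continuous[OF g continuous_trace_endo2[OF g k l]]
    by (simp add: calabi_metric_eq add_divide_distrib)
qed

lemma calabi_metric_self_left:
  assumes g: "g \<in> riem_metrics A"
  shows "calabi_metric A g g k = integral_tr g k / total_volume A g"
  using endo_self[OF g chart_at] by (simp add: calabi_metric_eq integral_tr_def)

lemma scale_metric:
  assumes g: "g \<in> riem_metrics A" and c: "c > 0"
  shows "c *\<^sub>T g \<in> riem_metrics A"
  using g scale_in_sym[OF metric_in_sym[OF g]] c
  unfolding riem_metrics_def by (auto simp: tscale_def scaleR_matrix_vector_assoc[symmetric])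

lemma endo_scale_metric:
  assumes g: "g \<in> riem_metrics A" and c: "c > 0" and d: "d \<in> A" "p \<in> fst d"
  shows "endo (c *\<^sub>T g) h d p = (1 / c) *\<^sub>R endo g h d p"
proof -
  have "(c *\<^sub>R g d p) ** ((1 / c) *\<^sub>R matrix_inv (g d p)) = mat 1"
    using matrix_inv_right[of "g d p"] metric_det_pos[OF g d] c
      matrix_mult_lincomb_left[of c "g d p" 0 0 "(1 / c) *\<^sub>R matrix_inv (g d p)"]
      matrix_mult_lincomb_right[of "g d p" "1 / c" "matrix_inv (g d p)" 0 0]
    by simp
  then have "matrix_inv (c *\<^sub>R g d p) = (1 / c) *\<^sub>R matrix_inv (g d p)" by (rule matrix_inv_eqI)
  then show ?thesis
    using matrix_mult_lincomb_left[of "1 / c" "matrix_inv (g d p)" 0 0 "h d p"]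
    by (simp add: endo_def tscale_def)
qed

text \<open>The volume factor \<open>d\<close> occurs in the integral and in the total volume and
  cancels, so its value is never computed. The two inverses of the metric leave the factor
  \<open>1 / c\<^sup>2\<close>, which scaling both tangent vectors by \<open>c\<close> would
  undo.\<close>

lemma calabi_metric_scale:
  assumes g: "g \<in> riem_metrics A" and h: "h \<in> sym_tensor_fields A" and k: "k \<in> sym_tensor_fields A"
    and c: "c > 0"
  shows "calabi_metric A (c *\<^sub>T g) h k = calabi_metric A g h k / c\<^sup>2"
proof -
  note cg = scale_metric[OF g c]
  define d where "d = sqrt (det (c *\<^sub>R (mat 1 :: real^'n::_^'n::_)))"
  have vr: "volume_ratio g (c *\<^sub>T g) p = d" for p
    using endo_lincomb[of g c g 0 g "chart_at A p" p] endo_self[OF g chart_at, of p]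
    by (simp add: volume_ratio_def d_def endo_def tscale_def)
  have V: "total_volume A (c *\<^sub>T g) = total_volume A g * d"
    using integral_change_metric[OF g cg, of "\<lambda>_. 1"]
    by (simp add: vr total_volume_def space_riem_volume g cg)
  then have d: "d \<noteq> 0" using total_volume_pos[OF cg] by auto
  have "tr2 (c *\<^sub>T g) h k p = tr2 g h k p / c\<^sup>2" for p
    using endo_scale_metric[OF g c chart_at[of p], of h] endo_scale_metric[OF g c chart_at[of p], of k]
      matrix_mult_lincomb_left[of "1 / c" "endo g h (chart_at A p) p" 0 0 "(1 / c) *\<^sub>R endo g k (chart_at A p) p"]
      matrix_mult_lincomb_right[of "endo g h (chart_at A p) p" "1 / c" "endo g k (chart_at A p) p" 0 0]
    by (simp add: trace_def sum_distrib_left[symmetric] power2_eq_square sum_divide_distrib)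
  then have "(\<integral>p. tr2 (c *\<^sub>T g) h k p \<partial>riem_volume A (c *\<^sub>T g)) = (\<integral>p. tr2 g h k p / c\<^sup>2 * d \<partial>riem_volume A g)"
    using integral_change_metric[OF g cg continuous_trace_endo2[OF cg h k]] vr by simp
  then show ?thesis using d by (simp add: calabi_metric_eq V)
qed

text \<open>With \<open>\<kappa> = \<gamma>\<close> the integral is n V. As g^-1 g is the identity,
  the first two terms of \<open>integral_tr_deriv\<close> cancel and the third is n/2 times the
  trace of g^-1 h.\<close>

lemma has_deriv_total_volume:
  assumes \<gamma>: "\<And>u. u \<in> J \<Longrightarrow> \<gamma> u \<in> riem_metrics A" and t: "t \<in> J"
    and h: "h \<in> sym_tensor_fields A" and \<gamma>': "has_tensor_deriv A J \<gamma> h t"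
  shows "((\<lambda>u. total_volume A (\<gamma> u)) has_real_derivative integral_tr (\<gamma> t) h / 2) (at t within J)"
proof -
  have g: "\<gamma> t \<in> riem_metrics A" using \<gamma> t .
  have "((\<lambda>u. integral_tr (\<gamma> u) (\<gamma> u) / CARD('n)) has_real_derivative
      integral_tr_deriv (\<gamma> t) (\<gamma> t) h h / CARD('n)) (at t within J)"
    by (intro DERIV_cdivide has_deriv_integral_tr \<gamma> metric_in_sym t h \<gamma>')
  moreover have "integral_tr_deriv (\<gamma> t) (\<gamma> t) h h = CARD('n) * (integral_tr (\<gamma> t) h / 2)"
    using endo_self[OF g chart_at] by (simp add: integral_tr_deriv_def integral_tr_def trace_I)
  ultimately show ?thesis
    using \<gamma> t by (auto intro: has_field_derivative_transform_within[where d = 1] simp: integral_tr_self)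
qed

text \<open>A closed form for the differential of log V, which can be differentiated along curves
  without passing through \<open>deriv\<close>.\<close>

definition dlog :: "('m, 'n) tensor \<Rightarrow> ('m, 'n) tensor \<Rightarrow> real" where
  "dlog g k = integral_tr g k / (2 * total_volume A g)"

text \<open>For \<open>l = 0\<close> this is the second derivative of log V in the ambient vector
  space, without Christoffel term.\<close>

definition dlog_deriv :: "('m, 'n) tensor \<Rightarrow> ('m, 'n) tensor \<Rightarrow> ('m, 'n) tensor \<Rightarrow> ('m, 'n) tensor \<Rightarrow> real" where
  "dlog_deriv g k h l = integral_tr_deriv g k h l / (2 * total_volume A g) - dlog g k * dlog g h"

lemma has_deriv_log_volume:
  assumes \<gamma>: "\<And>u. u \<in> J \<Longrightarrow> \<gamma> u \<in> riem_metrics A" and t: "t \<in> J"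
    and h: "h \<in> sym_tensor_fields A" and \<gamma>': "has_tensor_deriv A J \<gamma> h t"
  shows "((\<lambda>u. ln (total_volume A (\<gamma> u))) has_real_derivative dlog (\<gamma> t) h) (at t within J)"
  using has_deriv_total_volume[OF assms]
  by (auto intro!: derivative_eq_intros total_volume_pos \<gamma> t simp: dlog_def field_simps)

lemma has_deriv_dlog:
  assumes \<gamma>: "\<And>u. u \<in> J \<Longrightarrow> \<gamma> u \<in> riem_metrics A" and \<kappa>: "\<And>u. u \<in> J \<Longrightarrow> \<kappa> u \<in> sym_tensor_fields A"
    and t: "t \<in> J" and h: "h \<in> sym_tensor_fields A" and l: "l \<in> sym_tensor_fields A"
    and \<gamma>': "has_tensor_deriv A J \<gamma> h t" and \<kappa>': "has_tensor_deriv A J \<kappa> l t"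
  shows "((\<lambda>u. dlog (\<gamma> u) (\<kappa> u)) has_real_derivative dlog_deriv (\<gamma> t) (\<kappa> t) h l) (at t within J)"
proof -
  have V: "total_volume A (\<gamma> t) > 0" by (rule total_volume_pos[OF \<gamma>[OF t]])
  have "((\<lambda>u. integral_tr (\<gamma> u) (\<kappa> u) / (2 * total_volume A (\<gamma> u))) has_real_derivative
      (integral_tr_deriv (\<gamma> t) (\<kappa> t) h l * (2 * total_volume A (\<gamma> t))
        - integral_tr (\<gamma> t) (\<kappa> t) * (2 * (integral_tr (\<gamma> t) h / 2)))
      / ((2 * total_volume A (\<gamma> t)) * (2 * total_volume A (\<gamma> t)))) (at t within J)"
    using V by (intro DERIV_divide DERIV_cmult has_deriv_integral_tr has_deriv_total_volume assms) auto
  then show ?thesis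
    unfolding dlog_def dlog_deriv_def by (rule DERIV_cong) (use V in \<open>simp add: field_simps\<close>)
qed

lemma dlog_deriv_sym: "dlog_deriv g k h 0 = dlog_deriv g h k 0"
proof -
  have "tr2 g h k p = tr2 g k h p" for p by (rule tr2_sym)
  then show ?thesis by (simp add: dlog_deriv_def integral_tr_deriv_def mult.commute)
qed

text \<open>Separates the acceleration \<open>l\<close> of a curve from its velocity, as in (log
  V)'' = D^2 log V(c', c') + d log V(c'').\<close>

lemma dlog_deriv_split:
  assumes g: "g \<in> riem_metrics A" and k: "k \<in> sym_tensor_fields A"
    and h: "h \<in> sym_tensor_fields A" and l: "l \<in> sym_tensor_fields A"
  shows "dlog_deriv g k h l = dlog_deriv g k h 0 + dlog g l"
proof -
  let ?f = "\<lambda>p. tr g h p / 2 * tr g k p - tr2 g h k p"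
  have "continuous_on UNIV ?f"
    by (intro continuous_intros continuous_trace_endo continuous_trace_endo2 g h k) simp
  then have f: "integrable (riem_volume A g) ?f" by (rule integrable_continuous[OF g])
  have l': "integrable (riem_volume A g) (tr g l)"
    by (rule integrable_continuous[OF g continuous_trace_endo[OF g l]])
  have eq: "integral_tr_deriv g k h m = (\<integral>p. tr g m p + ?f p \<partial>riem_volume A g)" for m
    unfolding integral_tr_deriv_def by (simp add: algebra_simps)
  have "tr g 0 p = 0" for p by (simp add: endo_def trace_def)
  then have "integral_tr_deriv g k h l = integral_tr_deriv g k h 0 + integral_tr g l"
    unfolding eq integral_tr_def using f l' by simp
  then show ?thesis by (simp add: dlog_deriv_def dlog_def add_divide_distrib)
qed

text \<open>The derivative lemmas ask for curves of metrics, and the line through \<open>g\<close>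
  stays among metrics only for small \<open>s\<close>. So \<open>D\<close> is assumed relative to
  any admissible \<open>J\<close> and used for a neighbourhood of 0.\<close>

lemma dir_deriv_eqI:
  assumes g: "g \<in> riem_metrics A" and h: "h \<in> sym_tensor_fields A"
    and F: "\<And>g'. g' \<in> riem_metrics A \<Longrightarrow> f g' = F g'"
    and D: "\<And>J. 0 \<in> J \<Longrightarrow> (\<And>s. s \<in> J \<Longrightarrow> g + s *\<^sub>T h \<in> riem_metrics A) \<Longrightarrow>
      ((\<lambda>s. F (g + s *\<^sub>T h)) has_real_derivative D) (at 0 within J)"
  shows "dir_deriv f g h = D"
proof -
  obtain S where S: "open S" "0 \<in> S" "\<And>s. s \<in> S \<Longrightarrow> g + s *\<^sub>T h \<in> riem_metrics A"
    using eventually_metric[OF g h] unfolding eventually_nhds by blast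
  have "((\<lambda>s. F (g + s *\<^sub>T h)) has_real_derivative D) (at 0)"
    using D[OF S(2,3)] at_within_open[OF S(2,1)] by simp
  then have "((\<lambda>s. f (g + s *\<^sub>T h)) has_real_derivative D) (at 0)"
    by (rule has_field_derivative_transform_within_open[OF _ S(1,2)]) (simp add: F S)
  then show ?thesis unfolding dir_deriv_def by (rule DERIV_imp_deriv)
qed

lemma plus_zero_scale: "g + 0 *\<^sub>T h = (g :: ('m, 'n) tensor)"
  by (simp add: tscale_def fun_eq_iff)

lemma dir_deriv_log_volume:
  assumes g: "g \<in> riem_metrics A" and h: "h \<in> sym_tensor_fields A"
  shows "dir_deriv (\<lambda>g'. ln (total_volume A g')) g h = dlog g h"
proof (rule dir_deriv_eqI[OF g h refl])
  fix J :: "real set" assume "0 \<in> J" "\<And>s. s \<in> J \<Longrightarrow> g + s *\<^sub>T h \<in> riem_metrics A"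
  from has_deriv_log_volume[OF this(2) this(1) h has_tensor_deriv_affine]
  show "((\<lambda>s. ln (total_volume A (g + s *\<^sub>T h))) has_real_derivative dlog g h) (at 0 within J)"
    by (simp add: plus_zero_scale)
qed

text \<open>The factor \<open>a\<close> is 1 for the differential of log V and 2 for g_N(g,
  k).\<close>

lemma dir_deriv_dlog:
  assumes g: "g \<in> riem_metrics A" and h: "h \<in> sym_tensor_fields A" and k: "k \<in> sym_tensor_fields A"
    and f: "\<And>g'. g' \<in> riem_metrics A \<Longrightarrow> f g' = a * dlog g' k"
  shows "dir_deriv f g h = a * dlog_deriv g k h 0"
proof (rule dir_deriv_eqI[OF g h f])
  fix J :: "real set" assume J: "0 \<in> J" "\<And>s. s \<in> J \<Longrightarrow> g + s *\<^sub>T h \<in> riem_metrics A"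
  have "((\<lambda>s. dlog (g + s *\<^sub>T h) k) has_real_derivative dlog_deriv (g + 0 *\<^sub>T h) k h 0) (at 0 within J)"
    by (rule has_deriv_dlog[where \<gamma> = "\<lambda>s. g + s *\<^sub>T h" and \<kappa> = "\<lambda>_. k"])
      (simp_all add: J h k zero_in_sym[OF k] has_tensor_deriv_affine has_tensor_deriv_const)
  then show "((\<lambda>s. a * dlog (g + s *\<^sub>T h) k) has_real_derivative a * dlog_deriv g k h 0) (at 0 within J)"
    unfolding plus_zero_scale by (rule DERIV_cmult)
qed

lemma dir_deriv_calabi_metric_radial:
  assumes g: "g \<in> riem_metrics A" and h: "h \<in> sym_tensor_fields A" and k: "k \<in> sym_tensor_fields A"
  shows "dir_deriv (\<lambda>g'. calabi_metric A g' h k) g g = - 2 * calabi_metric A g h k"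
  unfolding dir_deriv_def
proof (rule DERIV_imp_deriv)
  have "((\<lambda>s. calabi_metric A g h k / (1 + s)\<^sup>2) has_real_derivative - 2 * calabi_metric A g h k) (at 0)"
    by (auto intro!: derivative_eq_intros)
  then show "((\<lambda>s. calabi_metric A (g + s *\<^sub>T g) h k) has_real_derivative - 2 * calabi_metric A g h k) (at 0)"
  proof (rule has_field_derivative_transform_within_open[where S = "{-1<..<1}"])
    fix s :: real assume s: "s \<in> {-1<..<1}"
    have "g + s *\<^sub>T g = (1 + s) *\<^sub>T g" by (simp add: tscale_def fun_eq_iff scaleR_add_left)
    then show "calabi_metric A g h k / (1 + s)\<^sup>2 = calabi_metric A (g + s *\<^sub>T g) h k"
      using calabi_metric_scale[OF g h k, of "1 + s"] s by simp
  qed auto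
qed

section \<open>Consequences of the Levi-Civita conditions\<close>

context
  fixes \<Gamma> :: "('m, 'n) christoffel"
  assumes lc: "levi_civita A (calabi_metric A) \<Gamma>"
begin

lemma christoffel_in_sym:
  "g \<in> riem_metrics A \<Longrightarrow> h \<in> sym_tensor_fields A \<Longrightarrow> k \<in> sym_tensor_fields A \<Longrightarrow> \<Gamma> g h k \<in> sym_tensor_fields A"
  using lc unfolding levi_civita_def linear_connection_def by blast

text \<open>Vanishing torsion is tested on constant fields, whose directional derivatives vanish, so
  that only the Christoffel terms remain.\<close>

lemma christoffel_sym:
  assumes g: "g \<in> riem_metrics A" and h: "h \<in> sym_tensor_fields A" and k: "k \<in> sym_tensor_fields A"
  shows "\<Gamma> g h k = \<Gamma> g k h"
proof -
  have "covariant_deriv A \<Gamma> (\<lambda>_. h) (\<lambda>_. k) g - covariant_deriv A \<Gamma> (\<lambda>_. k) (\<lambda>_. h) g = lie_bracket A (\<lambda>_. h) (\<lambda>_. k) g"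
    using lc g smooth_vector_field_const[OF h] smooth_vector_field_const[OF k] unfolding levi_civita_def by blast
  then show ?thesis
    by (simp add: covariant_deriv_def lie_bracket_def field_dir_deriv_const h k)
qed

lemma metric_compatible:
  assumes "smooth_vector_field A X" "smooth_vector_field A Y" "smooth_vector_field A Z" "g \<in> riem_metrics A"
  shows "dir_deriv (\<lambda>g'. calabi_metric A g' (Y g') (Z g')) g (X g) =
    calabi_metric A g (covariant_deriv A \<Gamma> X Y g) (Z g) + calabi_metric A g (Y g) (covariant_deriv A \<Gamma> X Z g)"
  using lc assms unfolding levi_civita_def by blast

lemma
  assumes g: "g \<in> riem_metrics A" and h: "h \<in> sym_tensor_fields A" and k: "k \<in> sym_tensor_fields A"
  shows hessian_log_volume: "hessian \<Gamma> (\<lambda>g'. ln (total_volume A g')) g h k = 0"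
    and dlog_deriv_christoffel: "dlog_deriv g k h 0 = dlog g (\<Gamma> g h k)"
proof -
  note const = smooth_vector_field_const and id = smooth_vector_field_id[of A]
  note gs = metric_in_sym[OF g]
  let ?G = "calabi_metric A g"
  have G_self: "?G g m = 2 * dlog g m" for m
    by (simp add: calabi_metric_self_left[OF g] dlog_def)
  \<comment> \<open>Compatibility for the constant fields \<open>l\<close>, \<open>m\<close> and the
    radial field, whose covariant derivative along \<open>l\<close> is
    \<open>l + \<Gamma> g l g\<close>. Its pairing with \<open>m\<close> is thus twice the Hessian
    of log V on \<open>l\<close> and \<open>m\<close>.\<close>
  have E: "2 * dlog_deriv g m l 0 = ?G (l + \<Gamma> g l g) m + 2 * dlog g (\<Gamma> g l m)"
    if l: "l \<in> sym_tensor_fields A" and m: "m \<in> sym_tensor_fields A" for l m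
  proof -
    have "dir_deriv (\<lambda>g'. calabi_metric A g' g' m) g l = 2 * dlog_deriv g m l 0"
      by (rule dir_deriv_dlog[OF g l m]) (simp add: calabi_metric_self_left dlog_def)
    then show ?thesis
      using metric_compatible[OF const[OF l] id const[OF m] g]
      by (simp add: covariant_deriv_def field_dir_deriv_const field_dir_deriv_id l m G_self)
  qed
  let ?S = "\<lambda>l m. ?G (l + \<Gamma> g l g) m"
  \<comment> \<open>The Hessian is symmetric, since both the second derivative of log V and the
    Christoffel map are.\<close>
  have sym: "?S h k = ?S k h"
    using E[OF h k] E[OF k h] dlog_deriv_sym[of g k h] christoffel_sym[OF g h k] by simp
  \<comment> \<open>The Killing equation: adding \<open>?G h k\<close> once for
    \<open>?S h k\<close> and once for \<open>?S k h\<close> uses up the left side, so these two sum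
    to 0.\<close>
  have "- 2 * ?G h k = ?G (\<Gamma> g g h) k + ?G h (\<Gamma> g g k)"
    using metric_compatible[OF id const[OF h] const[OF k] g] dir_deriv_calabi_metric_radial[OF g h k]
    by (simp add: covariant_deriv_def field_dir_deriv_const h k)
  moreover have "?S h k = ?G h k + ?G (\<Gamma> g g h) k"
    using calabi_metric_add[OF g h christoffel_in_sym[OF g h gs] k] christoffel_sym[OF g h gs] by simp
  moreover have "?S k h = ?G h k + ?G h (\<Gamma> g g k)"
    using calabi_metric_add[OF g k christoffel_in_sym[OF g k gs] h] christoffel_sym[OF g k gs]
    by (simp add: calabi_metric_sym[of g h])
  ultimately have "?S h k = 0" using sym by simp
  then show *: "dlog_deriv g k h 0 = dlog g (\<Gamma> g h k)" using E[OF h k] by simp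
  have "dir_deriv (\<lambda>g'. dir_deriv (\<lambda>g'. ln (total_volume A g')) g' k) g h = 1 * dlog_deriv g k h 0"
    by (rule dir_deriv_dlog[OF g h k]) (simp add: dir_deriv_log_volume k)
  then show "hessian \<Gamma> (\<lambda>g'. ln (total_volume A g')) g h k = 0"
    using * dir_deriv_log_volume[OF g christoffel_in_sym[OF g h k]]
    by (simp add: hessian_def covariant_deriv_form_def)
qed

text \<open>By the vanishing Hessian the second derivative of log V along the curve is d log V
  applied to \<gamma>'' + \<Gamma>(\<gamma>', \<gamma>'), which the geodesic equation makes
  zero.\<close>

lemma log_volume_geodesic:
  assumes geo: "geodesic A \<Gamma> J \<gamma>"
  shows "\<exists>a b. \<forall>t\<in>J. ln (total_volume A (\<gamma> t)) = a * t + b"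
proof -
  have J: "is_interval J" "interior J \<noteq> {}" and \<gamma>: "\<And>t. t \<in> J \<Longrightarrow> \<gamma> t \<in> riem_metrics A"
    using geo by (auto simp: geodesic_def)
  obtain D where D: "D 0 = \<gamma>"
    "\<And>k t. t \<in> J \<Longrightarrow> D k t \<in> sym_tensor_fields A"
    "\<And>k t. t \<in> J \<Longrightarrow> has_tensor_deriv A J (D k) (D (Suc k) t) t"
    using geo unfolding geodesic_def smooth_curve_def by blast
  \<comment> \<open>An interval with non-empty interior has no isolated points, so derivatives
    within it are unique even at its end points.\<close>
  have nontriv: "at t within J \<noteq> bot" if "t \<in> J" for t
  proof -
    have "J \<noteq> {a}" for a using J(2) by auto
    then show ?thesis
      using connected_imp_perfect[of J t] that J(1) by (auto simp: trivial_limit_within is_interval_connected_1)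
  qed
  have D1: "tensor_deriv A J \<gamma> t = D 1 t" if "t \<in> J" for t
    using tensor_deriv_eqI[OF D(2)[OF that, of 1] _ nontriv[OF that]] D(3)[OF that, of 0] D(1) by simp
  \<comment> \<open>\<open>tensor_deriv A J \<gamma>\<close> is known to be \<open>D 1\<close> only
    on \<open>J\<close>, and difference quotients within \<open>J\<close> see no other
    points.\<close>
  have D2: "tensor_deriv A J (tensor_deriv A J \<gamma>) t = D 2 t" if t: "t \<in> J" for t
  proof (rule tensor_deriv_eqI[OF D(2)[OF t] _ nontriv[OF t]])
    have "eventually (\<lambda>u. (1 / (u - t)) *\<^sub>T (tensor_deriv A J \<gamma> u - tensor_deriv A J \<gamma> t) =
        (1 / (u - t)) *\<^sub>T (D 1 u - D 1 t)) (at t within J)"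
      using t by (auto simp: eventually_at_filter D1)
    from tensor_tendsto_cong[OF this] show "has_tensor_deriv A J (tensor_deriv A J \<gamma>) (D 2 t) t"
      using D(3)[OF t, of 1] by (simp add: has_tensor_deriv_def numeral_2_eq_2)
  qed
  let ?\<phi> = "\<lambda>t. dlog (\<gamma> t) (D 1 t)"
  have \<phi>: "((\<lambda>t. ln (total_volume A (\<gamma> t))) has_real_derivative ?\<phi> t) (at t within J)" if t: "t \<in> J" for t
    using has_deriv_log_volume[OF \<gamma> t D(2)[OF t]] D(3)[OF t, of 0] D(1) by simp
  have \<phi>0: "(?\<phi> has_real_derivative 0) (at t within J)" if t: "t \<in> J" for t
  proof -
    have g: "\<gamma> t \<in> riem_metrics A" using \<gamma> t .
    note d = D(2)[OF t, of 1] D(2)[OF t, of 2]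
    let ?k = "\<Gamma> (\<gamma> t) (D 1 t) (D 1 t)"
    have "(?\<phi> has_real_derivative dlog_deriv (\<gamma> t) (D 1 t) (D 1 t) (D 2 t)) (at t within J)"
      using D(3)[OF t, of 0] D(3)[OF t, of 1] D(1) d
      by (intro has_deriv_dlog \<gamma> D(2) t) (simp_all add: numeral_2_eq_2)
    also have "dlog_deriv (\<gamma> t) (D 1 t) (D 1 t) (D 2 t) = dlog (\<gamma> t) ?k + dlog (\<gamma> t) (D 2 t)"
      using dlog_deriv_split[OF g d(1) d(1) d(2)] dlog_deriv_christoffel[OF g d(1) d(1)] by simp
    also have "\<dots> = dlog (\<gamma> t) (1 *\<^sub>T D 2 t + 1 *\<^sub>T ?k)"
      using integral_tr_lincomb[OF g d(2) christoffel_in_sym[OF g d(1) d(1)], of 1 1]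
      by (simp add: dlog_def add_divide_distrib)
    also have "1 *\<^sub>T D 2 t + 1 *\<^sub>T ?k = D 2 t + ?k" by (simp add: tscale_def)
    also have "\<dots> = 0" using geo t unfolding geodesic_def D1[OF t, symmetric] D2[OF t, symmetric] by blast
    also have "dlog (\<gamma> t) 0 = 0"
      by (simp add: dlog_def integral_tr_def endo_def trace_def)
    finally show ?thesis .
  qed
  have convex: "convex J" using J(1) by (rule is_interval_convex)
  obtain a where a: "\<And>t. t \<in> J \<Longrightarrow> ?\<phi> t = a"
    using has_field_derivative_zero_constant[OF convex \<phi>0] by blast
  have "((\<lambda>t. ln (total_volume A (\<gamma> t)) - a * t) has_real_derivative 0) (at t within J)" if "t \<in> J" for t
    using DERIV_diff[OF \<phi>[OF that] DERIV_cmult[OF DERIV_ident, where c = a]] a[OF that] by simp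
  then obtain b where "\<And>t. t \<in> J \<Longrightarrow> ln (total_volume A (\<gamma> t)) - a * t = b"
    using has_field_derivative_zero_constant[OF convex, of "\<lambda>t. ln (total_volume A (\<gamma> t)) - a * t"] by blast
  then have "\<forall>t\<in>J. ln (total_volume A (\<gamma> t)) = a * t + b" by (force simp: algebra_simps)
  then show ?thesis by blast
qed

lemma volume_geodesic:
  assumes geo: "geodesic A \<Gamma> J \<gamma>"
  shows "strict_mono_on J (\<lambda>t. total_volume A (\<gamma> t)) \<or>
    strict_antimono_on J (\<lambda>t. total_volume A (\<gamma> t)) \<or>
    (\<lambda>t. total_volume A (\<gamma> t)) constant_on J"
proof -
  obtain a b where "\<forall>t\<in>J. ln (total_volume A (\<gamma> t)) = a * t + b"
    using log_volume_geodesic[OF geo] by blast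
  moreover have "\<gamma> t \<in> riem_metrics A" if "t \<in> J" for t using geo that by (auto simp: geodesic_def)
  ultimately have V: "total_volume A (\<gamma> t) = exp (a * t + b)" if "t \<in> J" for t
    using total_volume_pos that by (metis exp_ln)
  consider "a > 0" | "a < 0" | "a = 0" by linarith
  then show ?thesis
  proof cases
    case 1
    then have "strict_mono_on J (\<lambda>t. total_volume A (\<gamma> t))" by (auto simp: monotone_on_def V)
    then show ?thesis ..
  next
    case 2
    then have "strict_antimono_on J (\<lambda>t. total_volume A (\<gamma> t))" by (auto simp: monotone_on_def V)
    then show ?thesis by blast
  next
    case 3
    then show ?thesis by (auto simp: constant_on_def V)
  qed
qed

end

end

theorem corollary3p2:
  fixes A :: "('m::t2_space, 'n::{finite,wellorder}) chart set"
    and \<Gamma> :: "('m, 'n) christoffel"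
  assumes "closed_manifold A"
    and "levi_civita A (calabi_metric A) \<Gamma>"
  shows "(\<forall>g\<in>riem_metrics A. \<forall>h\<in>sym_tensor_fields A. \<forall>k\<in>sym_tensor_fields A.
            hessian \<Gamma> (\<lambda>g'. ln (total_volume A g')) g h k = 0) \<and>
         (\<forall>J \<gamma>. geodesic A \<Gamma> J \<gamma> \<longrightarrow>
            (\<exists>a b. \<forall>t\<in>J. ln (total_volume A (\<gamma> t)) = a * t + b) \<and>
            (strict_mono_on J (\<lambda>t. total_volume A (\<gamma> t)) \<or>
             strict_antimono_on J (\<lambda>t. total_volume A (\<gamma> t)) \<or>
             (\<lambda>t. total_volume A (\<gamma> t)) constant_on J))"
proof -
  interpret closed_mfd A by unfold_locales (rule assms(1))
  show ?thesis
    using hessian_log_volume[OF assms(2)] log_volume_geodesic[OF assms(2)] volume_geodesic[OF assms(2)]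
    by blast
qed

end
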